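(* Let $B$ be a cylindrical Brownian motion. There exists a Borel mapping $b\colon [0,1]\times\mathbb{R}^\infty\to\mathbb{R}^\infty$ such that the equation $$X_t=\int_{[0,t]} b(s,X_s)\,ds+B_t,\qquad X_0=0,\quad t\in[0,1],$$ has the following properties: (1) there exists a set $\Omega\subset C([0,1],\mathbb{R}^\infty)$ of Brownian trajectories of full measure (with respect to the law of $B$) such that for every $B\in\Omega$ the integral equation has at least two different solutions (understood in the pure ODE sense) defined on the whole interval $[0,1]$; (2) pathwise uniqueness holds in the sense that for any Markov moment $\tau$ there exists a unique weak solution to the SDE defined up to the moment $\tau$, this solution is strong, and pathwise uniqueness holds (for solutions defined up to $\tau$).
   Context: $\mathbb{R}^\infty$ is the space of real sequences (countable product of copies of $\mathbb{R}$) with the product topology and Borel $\sigma$-algebra. A cylindrical Brownian motion is an $\mathbb{R}^\infty$-valued process whose coordinates are independent standard one-dimensional Brownian motions. Integrals are taken coordinatewise. Pure ODE sense: for a fixed continuous trajectory $B$, a solution is a continuous function $t\mapsto X_t\in\mathbb{R}^\infty$ on $[0,1]$ satisfying the integral equation for all $t\in[0,1]$ (with each coordinate of $s\mapsto b(s,X_s)$ Lebesgue integrable); no adaptedness is required. A Markov moment is a stopping time $\tau$ of the filtration $(\mathcal{F}_t)_{t\ge0}$ of a filtered probability space (with complete filtration) carrying a cylindrical Brownian motion $B$ with respect to $(\mathcal{F}_t)$. A weak solution defined up to $\tau$ is a pair $(B,X)$ with $X$ a continuous $(\mathcal{F}_t)$-adapted process such that a.s. the integral equation holds for all $t\in[0,1]$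 with $t\le\tau$. Processes defined up to $\tau$ are identified if they a.s. coincide for all $t\in[0,1]$ with $t\le\tau$. Such a solution is strong if up to $\tau$ it coincides a.s. with a process adapted to the completed filtration generated by $B$. Pathwise uniqueness up to $\tau$: any two solutions $(B,X)$, $(B,Y)$ defined up to $\tau$ on the same filtered probability space with the same $B$ satisfy a.s. $X_t=Y_t$ for all $t\in[0,1]$ with $t\le\tau$. *)

theory Defs
  imports "HOL-Probability.Probability"
begin

(* R^infinity is the type nat \<Rightarrow> real: its library topology is the product topology,
   and borel is the corresponding Borel sigma-algebra. *)
type_synonym rseq = "nat \<Rightarrow> real"
type_synonym drift = "real \<times> rseq \<Rightarrow> rseq"

definition standard_bm :: "'a measure \<Rightarrow> (real \<Rightarrow> 'a \<Rightarrow> real) \<Rightarrow> bool" where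
  "standard_bm M W \<longleftrightarrow>
     (\<forall>t\<ge>0. W t \<in> borel_measurable M) \<and>
     (AE \<omega> in M. W 0 \<omega> = 0) \<and>
     (\<forall>\<omega>\<in>space M. continuous_on {0..} (\<lambda>t. W t \<omega>)) \<and>
     (\<forall>s t. 0 \<le> s \<and> s < t \<longrightarrow>
        distributed M lborel (\<lambda>\<omega>. W t \<omega> - W s \<omega>) (normal_density 0 (sqrt (t - s)))) \<and>
     (\<forall>t::nat \<Rightarrow> real. 0 \<le> t 0 \<and> incseq t \<longrightarrow>
        prob_space.indep_vars M (\<lambda>_. borel) (\<lambda>k \<omega>. W (t (Suc k)) \<omega> - W (t k) \<omega>) UNIV)"

(* The coordinates are independent as processes: each one is regarded as a random element
   of the product space of real functions on the half-line. *)
definition cylindrical_bm :: "'a measure \<Rightarrow> (real \<Rightarrow> 'a \<Rightarrow> rseq) \<Rightarrow> bool" where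
  "cylindrical_bm M B \<longleftrightarrow>
     (\<forall>i. standard_bm M (\<lambda>t \<omega>. B t \<omega> i)) \<and>
     prob_space.indep_vars M (\<lambda>_. Pi\<^sub>M {0..} (\<lambda>_. borel)) (\<lambda>i \<omega>. \<lambda>t\<in>{0..}. B t \<omega> i) UNIV"

(* C([0,1], R^infinity), as extensional functions on [0,1]. The sigma-algebra generated by the
   evaluations is the Borel sigma-algebra of uniform convergence of each coordinate. *)
definition path_space :: "(real \<Rightarrow> rseq) measure" where
  "path_space = restrict_space (Pi\<^sub>M {0..1} (\<lambda>_. borel)) {w. continuous_on {0..1} w}"

definition path_law :: "'a measure \<Rightarrow> (real \<Rightarrow> 'a \<Rightarrow> rseq) \<Rightarrow> (real \<Rightarrow> rseq) measure" where
  "path_law M B = distr M path_space (\<lambda>\<omega>. \<lambda>t\<in>{0..1}. B t \<omega>)"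

(* The integral must exist: for a non-integrable function the library integral is 0. *)
definition integral_eq_at ::
    "drift \<Rightarrow> (real \<Rightarrow> rseq) \<Rightarrow> (real \<Rightarrow> rseq) \<Rightarrow> real \<Rightarrow> bool" where
  "integral_eq_at b \<beta> x t \<longleftrightarrow>
     (\<forall>i. set_integrable lborel {0..t} (\<lambda>s. b (s, x s) i) \<and>
          x t i = (LINT s:{0..t}|lborel. b (s, x s) i) + \<beta> t i)"

definition ode_solution :: "drift \<Rightarrow> (real \<Rightarrow> rseq) \<Rightarrow> (real \<Rightarrow> rseq) \<Rightarrow> bool" where
  "ode_solution b \<beta> x \<longleftrightarrow>
     continuous_on {0..1} x \<and> x 0 = (\<lambda>_. 0) \<and> (\<forall>t\<in>{0..1}. integral_eq_at b \<beta> x t)"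

(* The index set [0,\<infinity>] of the filtration is ennreal, so that the library's stopping times
   may be infinite; F \<infinity> only has to contain every F t and imposes no further condition. *)
definition brownian_basis ::
    "'a measure \<Rightarrow> (ennreal \<Rightarrow> 'a measure) \<Rightarrow> (real \<Rightarrow> 'a \<Rightarrow> rseq) \<Rightarrow> bool" where
  "brownian_basis M F B \<longleftrightarrow>
     prob_space M \<and> complete_measure M \<and>
     filtration (space M) F \<and> (\<forall>t. sets (F t) \<subseteq> sets M) \<and> null_sets M \<subseteq> sets (F 0) \<and>
     cylindrical_bm M B \<and>
     (\<forall>t\<ge>0. B t \<in> borel_measurable (F (ennreal t))) \<and>
     (\<forall>s t. 0 \<le> s \<and> s \<le> t \<longrightarrow>
        prob_space.indep_set M (sets (F (ennreal s)))
          {(\<lambda>\<omega> i. B t \<omega> i - B s \<omega> i) -` A \<inter> space M | A. A \<in> sets borel})"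

definition coincide_upto ::
    "'a measure \<Rightarrow> ('a \<Rightarrow> ennreal) \<Rightarrow> (real \<Rightarrow> 'a \<Rightarrow> rseq) \<Rightarrow> (real \<Rightarrow> 'a \<Rightarrow> rseq) \<Rightarrow> bool" where
  "coincide_upto M \<tau> X Y \<longleftrightarrow>
     (AE \<omega> in M. \<forall>t\<in>{0..1}. ennreal t \<le> \<tau> \<omega> \<longrightarrow> X t \<omega> = Y t \<omega>)"

(* X solves the equation up to \<tau> with the driving process B of a given Brownian basis. *)
definition weak_solution_upto ::
    "drift \<Rightarrow> 'a measure \<Rightarrow> (ennreal \<Rightarrow> 'a measure) \<Rightarrow> (real \<Rightarrow> 'a \<Rightarrow> rseq) \<Rightarrow>
     ('a \<Rightarrow> ennreal) \<Rightarrow> (real \<Rightarrow> 'a \<Rightarrow> rseq) \<Rightarrow> bool" where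
  "weak_solution_upto b M F B \<tau> X \<longleftrightarrow>
     (\<forall>t\<in>{0..1}. X t \<in> borel_measurable (F (ennreal t))) \<and>
     (\<forall>\<omega>\<in>space M. continuous_on {0..1} (\<lambda>t. X t \<omega>)) \<and>
     (AE \<omega> in M. X 0 \<omega> = (\<lambda>_. 0) \<and>
        (\<forall>t\<in>{0..1}. ennreal t \<le> \<tau> \<omega> \<longrightarrow> integral_eq_at b (\<lambda>s. B s \<omega>) (\<lambda>s. X s \<omega>) t))"

definition completed_filtration ::
    "'a measure \<Rightarrow> (real \<Rightarrow> 'a \<Rightarrow> rseq) \<Rightarrow> real \<Rightarrow> 'a measure" where
  "completed_filtration M B t =
     sigma (space M)
       ({B s -` A \<inter> space M | s A. s \<in> {0..t} \<and> A \<in> sets borel} \<union> null_sets M)"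

definition strong_upto ::
    "'a measure \<Rightarrow> (real \<Rightarrow> 'a \<Rightarrow> rseq) \<Rightarrow> ('a \<Rightarrow> ennreal) \<Rightarrow> (real \<Rightarrow> 'a \<Rightarrow> rseq) \<Rightarrow> bool" where
  "strong_upto M B \<tau> X \<longleftrightarrow>
     (\<exists>Z. (\<forall>t\<in>{0..1}. Z t \<in> borel_measurable (completed_filtration M B t)) \<and>
          coincide_upto M \<tau> X Z)"

definition pathwise_unique_upto ::
    "drift \<Rightarrow> 'a measure \<Rightarrow> (ennreal \<Rightarrow> 'a measure) \<Rightarrow> (real \<Rightarrow> 'a \<Rightarrow> rseq) \<Rightarrow>
     ('a \<Rightarrow> ennreal) \<Rightarrow> bool" where
  "pathwise_unique_upto b M F B \<tau> \<longleftrightarrow>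
     (\<forall>X Y. weak_solution_upto b M F B \<tau> X \<and> weak_solution_upto b M F B \<tau> Y \<longrightarrow>
        coincide_upto M \<tau> X Y)"

(* The TYPE('a) argument fixes the type of the sample points: the two properties
   below range over all probability spaces whose points have type 'a. *)
definition ode_nonuniqueness :: "'a itself \<Rightarrow> drift \<Rightarrow> bool" where
  "ode_nonuniqueness (_ :: 'a itself) b \<longleftrightarrow>
     (\<forall>(M :: 'a measure) B. prob_space M \<and> cylindrical_bm M B \<longrightarrow>
        (\<exists>\<Omega>\<in>sets path_space. measure (path_law M B) \<Omega> = 1 \<and>
           (\<forall>\<beta>\<in>\<Omega>. \<exists>x y. ode_solution b \<beta> x \<and> ode_solution b \<beta> y \<and>
                          (\<exists>t\<in>{0..1}. x t \<noteq> y t))))"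

definition strong_well_posedness :: "'a itself \<Rightarrow> drift \<Rightarrow> bool" where
  "strong_well_posedness (_ :: 'a itself) b \<longleftrightarrow>
     (\<forall>(M :: 'a measure) F B \<tau>. brownian_basis M F B \<and> stopping_time F \<tau> \<longrightarrow>
        (\<exists>X. weak_solution_upto b M F B \<tau> X \<and>
             (\<forall>Y. weak_solution_upto b M F B \<tau> Y \<longrightarrow> coincide_upto M \<tau> Y X) \<and>
             strong_upto M B \<tau> X) \<and>
        pathwise_unique_upto b M F B \<tau>)"

definition counterexample_drift :: "'a itself \<Rightarrow> drift \<Rightarrow> bool" where
  "counterexample_drift (T :: 'a itself) b \<longleftrightarrow>
     b \<in> borel_measurable (restrict_space borel ({0..1} \<times> UNIV)) \<and>
     ode_nonuniqueness T b \<and> strong_well_posedness T b"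

(* HOL cannot quantify over types below an existential quantifier. To have one drift b serve
   all sample spaces, the theorem asserts a b for sample points of this type, and that each such b
   works for every type 'a. The type is big enough to hold a Brownian path, two solution paths and
   a stopping time at once, to which any filtered probability space can be reduced by its image. *)
type_synonym path_sample = "real \<Rightarrow> rseq"

end

theory Submission
  imports Defs
begin

text \<open>
  The drift acts only on trajectories that carry a correct prediction of their own future noise. A
  solution in the pure ODE sense may be chosen with knowledge of the whole trajectory of the
  noise, so it can carry such a prediction; an adapted solution cannot.

  Coordinate 0 receives no drift, so it shows the noise \<open>B\<^sup>0\<close>. The other coordinates are grouped
  into channels \<open>c\<close> of infinitely many copies \<open>l\<close>, and the drift moves copy \<open>l\<close> of a channel
  \<open>2\<^sup>l\<close> times as fast as copy 0. Since Brownian coordinates divided by \<open>2\<^sup>l\<close> tend to 0, the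
  state \<open>X\<^sub>t\<close> reveals the accumulated drift \<open>D\<^sub>t\<close> of copy 0 of every channel exactly, for
  almost every \<open>t\<close>. Consider the mean velocity \<open>D\<^sub>t / t\<close>. The drift of copy 0 at time \<open>t\<close> is this
  velocity if its entry in channel 0 is 1 and its other entries code a path whose value at \<open>t\<close>
  is \<open>B\<^sup>0\<^sub>t\<close>; otherwise the drift is 0.

  Two solutions: \<open>X = B\<close> solves the equation because it has no displacement. So does \<open>B\<close> plus
  a drift with constant velocity \<open>m\<close>, where \<open>m\<close> codes the path of \<open>B\<^sup>0\<close> on the whole interval
  [0,1] (\<open>two_solutions\<close>).

  Uniqueness: channel 0 moves with velocity 0 or 1, so if its displacement at time \<open>t > 0\<close> is \<open>t\<close>,
  then the drift has been active at almost all earlier times. There \<open>D' = D / t\<close>, which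
  makes \<open>D\<^sub>s / s\<close> constant on \<open>(0, t]\<close>. For an adapted solution this constant is known at every
  time \<open>s \<in> (0, t)\<close>, and yet it codes the values of \<open>B\<^sup>0\<close> at almost all times in \<open>(s, t]\<close>. As \<open>B\<^sup>0\<^sub>r - B\<^sup>0\<^sub>s\<close> is
  independent of the past and has a density, such a prediction is almost surely wrong at almost
  every \<open>r\<close> (\<open>brownian_basis_path_value_wrong\<close>). Hence an adapted solution never has any drift and
  equals \<open>B\<close> as long as it solves the equation (\<open>weak_solution_coincides_with_noise\<close>).

  The passage from one sample space to all others sends a sample point to the code of everything
  the properties speak about: the trajectory of the noise, two candidate solutions and the
  stopping time. This code is a function from the reals to sequences. The image of a filtered
  probability space with a Brownian motion, under a map through which the motion factors, is again
  such a space when every \<open>\<sigma>\<close>-algebra is replaced by the largest one that keeps the map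
  measurable.
\<close>

section \<open>The drift\<close>

text \<open>The index of copy \<open>l\<close> in channel \<open>c\<close>; index 0 is left over for the undisturbed coordinate.\<close>

definition channel :: "nat \<Rightarrow> nat \<Rightarrow> nat" where
  "channel c l = Suc (prod_encode (c, l))"

definition reading :: "rseq \<Rightarrow> rseq" where
  "reading x c = lim (\<lambda>l. x (channel c l) / 2 ^ l)"

text \<open>Entry \<open>prod_encode (k, j)\<close> holds the value at the dyadic point \<open>j / 2\<^sup>k\<close>; these values determine
  a continuous path on [0,1], which \<open>path_value\<close> recovers.\<close>

definition path_code :: "(real \<Rightarrow> real) \<Rightarrow> rseq" where
  "path_code f n = (case prod_decode n of (k, j) \<Rightarrow> f (real j / 2 ^ k))"

definition path_value :: "rseq \<Rightarrow> real \<Rightarrow> real" where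
  "path_value m r = lim (\<lambda>k. m (prod_encode (k, nat \<lfloor>r * 2 ^ k\<rfloor>)))"

text \<open>Entry 0 of the velocity is a flag that fixes the scale: it confines the drift of channel 0 to the
  values 0 and 1, so that channel 0 records for how long the drift has been active.\<close>

definition foreseen :: "real \<Rightarrow> rseq \<Rightarrow> real \<Rightarrow> bool" where
  "foreseen r v y \<longleftrightarrow> v 0 = 1 \<and> path_value (\<lambda>n. v (Suc n)) r = y"

text \<open>At \<open>t = 0\<close> the division gives 0, so that the flag is down and the drift vanishes.\<close>

definition velocity :: "real \<Rightarrow> rseq \<Rightarrow> rseq" where
  "velocity t x c = reading x c / t"

definition clairvoyant_drift :: drift where
  "clairvoyant_drift = (\<lambda>(t, x) i. case i of 0 \<Rightarrow> 0 | Suc p \<Rightarrow>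
     if foreseen t (velocity t x) (x 0)
     then (case prod_decode p of (c, l) \<Rightarrow> 2 ^ l * velocity t x c) else 0)"

lemma clairvoyant_drift_0 [simp]: "clairvoyant_drift (t, x) 0 = 0"
  by (simp add: clairvoyant_drift_def)

lemma clairvoyant_drift_channel:
  "clairvoyant_drift (t, x) (channel c l) =
     (if foreseen t (velocity t x) (x 0) then 2 ^ l * velocity t x c else 0)"
  by (simp add: clairvoyant_drift_def channel_def)

lemma coordinate_cases:
  obtains "i = 0" | c l where "i = channel c l"
proof (cases i)
  case (Suc p)
  then have "i = channel (fst (prod_decode p)) (snd (prod_decode p))"
    by (simp add: channel_def)
  then show ?thesis using that by blast
qed (use that in blast)

lemma rseq_eqI:
  assumes "x 0 = y 0" and "\<And>c l. x (channel c l) = y (channel c l)"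
  shows "x = (y :: rseq)"
proof
  show "x i = y i" for i
    by (cases rule: coordinate_cases[of i]) (simp_all add: assms)
qed

lemma dyadic_floor_tendsto:
  fixes t :: real
  shows "(\<lambda>k. of_int \<lfloor>t * 2 ^ k\<rfloor> / 2 ^ k) \<longlonglongrightarrow> t"
proof (rule real_tendsto_sandwich)
  show "\<forall>\<^sub>F k in sequentially. t - 1 / 2 ^ k \<le> of_int \<lfloor>t * 2 ^ k\<rfloor> / 2 ^ k"
  proof (intro always_eventually allI)
    fix k :: nat
    have "t * 2 ^ k - 1 \<le> of_int \<lfloor>t * 2 ^ k\<rfloor>" by linarith
    then have "(t * 2 ^ k - 1) / 2 ^ k \<le> of_int \<lfloor>t * 2 ^ k\<rfloor> / 2 ^ k"
      by (rule divide_right_mono) simp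
    then show "t - 1 / 2 ^ k \<le> of_int \<lfloor>t * 2 ^ k\<rfloor> / 2 ^ k"
      by (simp add: diff_divide_distrib)
  qed
  show "\<forall>\<^sub>F k in sequentially. of_int \<lfloor>t * 2 ^ k\<rfloor> / 2 ^ k \<le> t"
    by (intro always_eventually allI) (simp add: divide_le_eq)
  have "(\<lambda>k. t - (1 / 2) ^ k) \<longlonglongrightarrow> t - 0"
    by (intro tendsto_diff tendsto_const LIMSEQ_realpow_zero) auto
  then show "(\<lambda>k. t - 1 / 2 ^ k) \<longlonglongrightarrow> t"
    by (simp add: power_one_over)
qed simp

lemma path_value_path_code:
  assumes f: "continuous_on {0..1} f" and r: "r \<in> {0..1}"
  shows "path_value (path_code f) r = f r"
proof -
  have nat_floor: "real (nat \<lfloor>r * 2 ^ k\<rfloor>) = of_int \<lfloor>r * 2 ^ k\<rfloor>" for k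
    using r by simp
  have "path_code f (prod_encode (k, nat \<lfloor>r * 2 ^ k\<rfloor>)) = f (of_int \<lfloor>r * 2 ^ k\<rfloor> / 2 ^ k)" for k
    by (simp only: path_code_def prod_encode_inverse prod.case nat_floor)
  moreover have "(\<lambda>k. f (of_int \<lfloor>r * 2 ^ k\<rfloor> / 2 ^ k)) \<longlonglongrightarrow> f r"
  proof (rule continuous_on_tendsto_compose[OF f dyadic_floor_tendsto r])
    have "of_int \<lfloor>r * 2 ^ k\<rfloor> / 2 ^ k \<in> {0..1::real}" for k
    proof -
      have "of_int \<lfloor>r * 2 ^ k\<rfloor> \<le> r * 2 ^ k" by simp
      also have "\<dots> \<le> 2 ^ k" using r by (simp add: mult_le_cancel_right1)
      finally show ?thesis using r by simp
    qed
    then show "\<forall>\<^sub>F k in sequentially. of_int \<lfloor>r * 2 ^ k\<rfloor> / 2 ^ k \<in> {0..1::real}"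
      by simp
  qed
  ultimately show ?thesis
    by (simp add: path_value_def limI)
qed

lemma measurable_path_value [measurable (raw)]:
  assumes m: "\<And>n. (\<lambda>z. m z n) \<in> borel_measurable N" and r: "r \<in> borel_measurable N"
  shows "(\<lambda>z. path_value (m z) (r z)) \<in> borel_measurable N"
  unfolding path_value_def
proof (rule borel_measurable_lim_metric)
  fix k
  have "(\<lambda>z. prod_encode (k, nat \<lfloor>r z * 2 ^ k\<rfloor>)) \<in> measurable N (count_space UNIV)"
    using r by measurable
  then show "(\<lambda>z. m z (prod_encode (k, nat \<lfloor>r z * 2 ^ k\<rfloor>))) \<in> borel_measurable N"
    using m by (rule measurable_compose_countable[rotated])
qed

lemma measurable_clairvoyant_drift: "clairvoyant_drift \<in> borel_measurable borel"
proof -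
  let ?P = "borel \<Otimes>\<^sub>M borel :: (real \<times> rseq) measure"
  have coord [measurable]: "(\<lambda>z::real \<times> rseq. snd z i) \<in> borel_measurable ?P" for i
    by (rule measurable_compose[OF measurable_snd measurable_product_coordinates])
  have vel [measurable]: "(\<lambda>z. velocity (fst z) (snd z) c) \<in> borel_measurable ?P" for c
    unfolding velocity_def reading_def
    by (intro borel_measurable_divide borel_measurable_lim_metric) measurable
  have "(\<lambda>z. clairvoyant_drift z i) \<in> borel_measurable ?P" for i
  proof (cases rule: coordinate_cases[of i])
    case (2 c l)
    have "(\<lambda>z. if foreseen (fst z) (velocity (fst z) (snd z)) (snd z 0)
        then 2 ^ l * velocity (fst z) (snd z) c else 0) \<in> borel_measurable ?P"
      unfolding foreseen_def by measurable
    then show ?thesis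
      using clairvoyant_drift_channel[of "fst z" "snd z" c l for z] by (simp add: 2)
  next
    case 1
    then show ?thesis
      using clairvoyant_drift_0[of "fst z" "snd z" for z] by simp
  qed
  then have "clairvoyant_drift \<in> borel_measurable ?P"
    by (rule measurable_coordinatewise_then_product)
  then show ?thesis
    by (simp add: borel_prod)
qed

definition negligible_noise :: "rseq \<Rightarrow> bool" where
  "negligible_noise y \<longleftrightarrow> (\<forall>c. (\<lambda>l. y (channel c l) / 2 ^ l) \<longlonglongrightarrow> 0)"

text \<open>This is why displacements grow like \<open>2\<^sup>l\<close> along the copies: after division by \<open>2\<^sup>l\<close> the noise
  disappears in the limit and only the displacement is left.\<close>

lemma reading_displaced:
  assumes "negligible_noise y"
    and "\<And>c l. x (channel c l) = y (channel c l) + 2 ^ l * d c"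
  shows "reading x = d"
proof
  fix c
  have "(\<lambda>l. y (channel c l) / 2 ^ l + d c) \<longlonglongrightarrow> 0 + d c"
    using assms(1) by (intro tendsto_add tendsto_const) (simp add: negligible_noise_def)
  then show "reading x c = d c"
    by (simp add: reading_def assms(2) add_divide_distrib limI)
qed

lemma continuous_on_rseq_iff:
  fixes x :: "real \<Rightarrow> rseq"
  shows "continuous_on S x \<longleftrightarrow> (\<forall>i. continuous_on S (\<lambda>t. x t i))"
proof
  show "continuous_on S x \<Longrightarrow> \<forall>i. continuous_on S (\<lambda>t. x t i)"
    by (rule allI) (rule continuous_on_product_then_coordinatewise)
  show "\<forall>i. continuous_on S (\<lambda>t. x t i) \<Longrightarrow> continuous_on S x"
    by (rule continuous_on_coordinatewise_then_product) (erule spec)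
qed

section \<open>Two solutions for every typical trajectory\<close>

lemma measurable_along_path:
  assumes b: "b \<in> borel_measurable borel" and x: "continuous_on S x" and S: "S \<in> sets borel"
  shows "set_borel_measurable borel S (\<lambda>s::real. (b :: drift) (s, x s) i)"
proof -
  let ?R = "restrict_space borel S :: real measure"
  have "(\<lambda>s. (s, x s)) \<in> measurable ?R (borel \<Otimes>\<^sub>M borel)"
    by (intro measurable_Pair borel_measurable_continuous_on_restrict x continuous_on_id)
  then have "(\<lambda>s. (s, x s)) \<in> measurable ?R borel"
    by (simp only: borel_prod)
  then have "(\<lambda>s. b (s, x s)) \<in> borel_measurable ?R"
    using b by (rule measurable_compose)
  then have "(\<lambda>s. b (s, x s) i) \<in> borel_measurable ?R"
    by (rule measurable_compose[OF _ measurable_product_coordinates])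
  then show ?thesis
    using S by (simp add: set_borel_measurable_def borel_measurable_restrict_space_iff)
qed

lemma integrable_indicator_Icc:
  fixes a b :: real
  shows "integrable lborel (indicat_real {a..b})"
  by (rule integrable_real_indicator) (simp_all add: emeasure_lborel_Icc_eq)

lemma integral_eq_at_constant_drift:
  assumes b: "b \<in> borel_measurable borel" and x: "continuous_on {0..1} x" and t: "t \<in> {0..1}"
    and ae: "AE s in lborel. s \<in> {0..1} \<longrightarrow> b (s, x s) = v"
    and eq: "x t = (\<lambda>i. t * v i + \<beta> t i)"
  shows "integral_eq_at b \<beta> x t"
  unfolding integral_eq_at_def
proof
  fix i
  let ?f = "\<lambda>s. b (s, x s) i"
  have m: "set_borel_measurable lborel {0..t} ?f"
    by (rule set_borel_measurable_subset[of lborel "{0..1}"])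
      (use measurable_along_path[OF b x] t in \<open>auto simp: set_borel_measurable_def\<close>)
  have ae': "AE s in lborel. indicator {0..t} s *\<^sub>R ?f s = indicator {0..t} s *\<^sub>R v i"
    using ae by eventually_elim (use t in \<open>auto simp: indicator_def\<close>)
  have "set_integrable lborel {0..t} ?f \<longleftrightarrow> set_integrable lborel {0..t} (\<lambda>_. v i)"
    using m unfolding set_integrable_def set_borel_measurable_def
    by (intro integrable_cong_AE ae') auto
  then have "set_integrable lborel {0..t} ?f"
    by (simp add: set_integrable_def integrable_indicator_Icc)
  moreover have "(LINT s:{0..t}|lborel. ?f s) = (LINT s:{0..t}|lborel. v i)"
    using m unfolding set_lebesgue_integral_def set_borel_measurable_def
    by (intro integral_cong_AE ae') auto
  moreover have "(LINT s:{0..t}|lborel. v i) = t * v i"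
    using t by (simp add: set_lebesgue_integral_def)
  ultimately show "set_integrable lborel {0..t} ?f \<and> x t i = (LINT s:{0..t}|lborel. ?f s) + \<beta> t i"
    by (simp add: eq)
qed

lemma trajectory_solves_own_equation:
  assumes \<beta>: "continuous_on {0..1} \<beta>"
    and noise: "AE s in lborel. s \<in> {0..1} \<longrightarrow> negligible_noise (\<beta> s)"
    and t: "t \<in> {0..1}"
  shows "integral_eq_at clairvoyant_drift \<beta> \<beta> t"
proof (rule integral_eq_at_constant_drift[OF measurable_clairvoyant_drift \<beta> t])
  show "AE s in lborel. s \<in> {0..1} \<longrightarrow> clairvoyant_drift (s, \<beta> s) = (\<lambda>_. 0)"
    using noise
  proof eventually_elim
    case (elim s)
    show ?case
    proof
      assume "s \<in> {0..1}"
      then have "reading (\<beta> s) = (\<lambda>_. 0)"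
        using elim by (intro reading_displaced[where y = "\<beta> s"]) auto
      then have "\<not> foreseen s (velocity s (\<beta> s)) (\<beta> s 0)"
        by (simp add: foreseen_def velocity_def)
      then show "clairvoyant_drift (s, \<beta> s) = (\<lambda>_. 0)"
        by (intro rseq_eqI) (simp_all add: clairvoyant_drift_channel)
    qed
  qed
qed simp

text \<open>The second solution travels with the velocity that codes its own undisturbed coordinate.
  The state shows this velocity at almost every time, and the coded value is then always right, so
  that the drift confirms the velocity.\<close>

lemma two_solutions:
  assumes \<beta>: "continuous_on {0..1} \<beta>" and \<beta>0: "\<beta> 0 = (\<lambda>_. 0)"
    and noise: "AE s in lborel. s \<in> {0..1} \<longrightarrow> negligible_noise (\<beta> s)"
  shows "\<exists>x y. ode_solution clairvoyant_drift \<beta> x \<and> ode_solution clairvoyant_drift \<beta> y \<and>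
               (\<exists>t\<in>{0..1}. x t \<noteq> y t)"
proof (intro exI conjI)
  define d where "d c = (case c of 0 \<Rightarrow> 1 | Suc n \<Rightarrow> path_code (\<lambda>t. \<beta> t 0) n)" for c :: nat
  define v where "v i = (case i of 0 \<Rightarrow> 0 | Suc p \<Rightarrow> (case prod_decode p of (c, l) \<Rightarrow> 2 ^ l * d c))" for i
  define y where "y t = (\<lambda>i. t * v i + \<beta> t i)" for t
  have v0: "v 0 = 0" and vc: "v (channel c l) = 2 ^ l * d c" for c l
    by (simp_all add: v_def channel_def)
  have cont: "continuous_on {0..1} (\<lambda>t. \<beta> t i)" for i
    using \<beta> unfolding continuous_on_rseq_iff by (rule spec)
  show "ode_solution clairvoyant_drift \<beta> \<beta>"
    using trajectory_solves_own_equation[OF \<beta> noise] \<beta> \<beta>0 by (simp add: ode_solution_def)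
  show "ode_solution clairvoyant_drift \<beta> y"
    unfolding ode_solution_def
  proof (intro conjI ballI)
    show "continuous_on {0..1} y"
      unfolding continuous_on_rseq_iff y_def by (intro allI continuous_intros cont)
    then show "integral_eq_at clairvoyant_drift \<beta> y t" if t: "t \<in> {0..1}" for t
    proof (rule integral_eq_at_constant_drift[OF measurable_clairvoyant_drift _ t])
      have "AE s in lborel. s \<noteq> (0::real)"
        by (rule AE_lborel_singleton)
      with noise show "AE s in lborel. s \<in> {0..1} \<longrightarrow> clairvoyant_drift (s, y s) = v"
      proof eventually_elim
        case (elim s)
        show ?case
        proof
          assume s: "s \<in> {0..1}"
          have "reading (y s) = (\<lambda>c. s * d c)"
            using elim s
            by (intro reading_displaced[where y = "\<beta> s"]) (auto simp: y_def vc)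
          then have vel: "velocity s (y s) = d"
            using elim by (simp add: velocity_def fun_eq_iff)
          have "path_value (\<lambda>n. d (Suc n)) s = \<beta> s 0"
            using path_value_path_code[OF cont s] by (simp add: d_def)
          then have "foreseen s (velocity s (y s)) (y s 0)"
            unfolding foreseen_def vel by (simp add: y_def v0) (simp add: d_def)
          then show "clairvoyant_drift (s, y s) = v"
            by (intro rseq_eqI) (simp_all add: clairvoyant_drift_channel vel v0 vc)
        qed
      qed
    qed (simp add: y_def)
    show "y 0 = (\<lambda>_. 0)"
      by (simp add: y_def \<beta>0)
  qed
  have "y 1 (channel 0 0) = 1 + \<beta> 1 (channel 0 0)"
    by (simp add: y_def vc) (simp add: d_def)
  then have "\<beta> 1 \<noteq> y 1" by (metis add_cancel_left_left zero_neq_one)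
  then show "\<exists>t\<in>{0..1}. \<beta> t \<noteq> y t" by (intro bexI[of _ 1]) auto
qed

section \<open>Foresight fixes the velocity\<close>

lemma integral_tail_eq:
  fixes g :: "real \<Rightarrow> real"
  assumes g: "set_integrable lborel {0..T} g" and "0 \<le> s" "s \<le> t" "t \<le> T"
  shows "(LINT u:{0..t}|lborel. g u) = (LINT u:{0..s}|lborel. g u) + integral {s..t} g"
proof -
  have "g integrable_on {0..t}" and t: "(LINT u:{0..t}|lborel. g u) = integral {0..t} g"
    using set_borel_integral_eq_integral[OF set_integrable_subset[OF g, of "{0..t}"]] assms by auto
  moreover have "(LINT u:{0..s}|lborel. g u) = integral {0..s} g"
    using set_borel_integral_eq_integral(2)[OF set_integrable_subset[OF g, of "{0..s}"]] assms by auto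
  ultimately show ?thesis
    using Henstock_Kurzweil_Integration.integral_combine[of 0 s t g] assms by simp
qed

text \<open>A continuous \<open>D\<close> with \<open>D' = D / t\<close> is differentiable away from 0, and the derivative of the
  quotient \<open>D / t\<close> vanishes.\<close>

lemma constant_velocity:
  fixes D g :: "real \<Rightarrow> real"
  assumes g: "set_integrable lborel {0..T} g"
    and D: "\<And>t. t \<in> {0..T} \<Longrightarrow> D t = (LINT u:{0..t}|lborel. g u)"
    and ae: "AE u in lborel. u \<in> {0..T} \<longrightarrow> g u = D u / u"
    and s: "0 < s" "s \<le> r" "r \<le> T"
  shows "D r / r = D s / s"
proof -
  have gi: "g integrable_on {0..T}"
    using set_borel_integral_eq_integral(1)[OF g] .
  have DI: "D t = integral {0..t} g" if "t \<in> {0..T}" for t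
    using that D[OF that] set_borel_integral_eq_integral(2)[OF set_integrable_subset[OF g, of "{0..t}"]]
    by auto
  have contD: "continuous_on {0..T} D"
    by (rule continuous_on_eq[OF indefinite_integral_continuous_1[OF gi]]) (simp add: DI)
  have contV: "continuous_on {s..T} (\<lambda>u. D u / u)"
    by (rule continuous_on_divide[OF continuous_on_subset[OF contD] continuous_on_id]) (use s in auto)
  obtain N where N: "\<And>u. u \<in> space lborel - N \<Longrightarrow> u \<in> {0..T} \<longrightarrow> g u = D u / u" "N \<in> null_sets lborel"
    using AE_E3[OF ae] by blast
  have neg: "negligible N"
    using N(2) by (simp add: negligible_iff_null_sets null_sets_completionI)
  have D_eq: "D t = D s + integral {s..t} (\<lambda>u. D u / u)" if t: "t \<in> {s..T}" for t
  proof -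
    have "integral {s..t} g = integral {s..t} (\<lambda>u. D u / u)"
      by (rule integral_spike[OF neg]) (use N(1) s t in auto)
    then show ?thesis
      using integral_tail_eq[OF g, of s t] s t by (simp add: D)
  qed
  have "((\<lambda>t. D t / t) has_real_derivative 0) (at t within {s..T})" if t: "t \<in> {s..T}" for t
  proof -
    have "((\<lambda>t. D s + integral {s..t} (\<lambda>u. D u / u)) has_real_derivative D t / t) (at t within {s..T})"
      using DERIV_add[OF DERIV_const integral_has_real_derivative[OF contV t]] by simp
    then have "(D has_real_derivative D t / t) (at t within {s..T})"
      by (rule has_field_derivative_transform_within[OF _ zero_less_one t]) (erule D_eq[symmetric])
    from DERIV_divide[OF this DERIV_ident] show ?thesis
      using s t by simp
  qed
  then obtain k where "\<forall>t\<in>{s..T}. D t / t = k"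
    using has_field_derivative_zero_constant[of "{s..T}" "\<lambda>t. D t / t"] by auto
  then show ?thesis using s by simp
qed

text \<open>The analytic core of uniqueness, stated for the displacements \<open>D c\<close> and drifts \<open>g c\<close> of the
  channels and for one path \<open>W\<close>. An active drift at a time \<open>t1\<close> forces activity at almost all
  earlier times, because channel 0 can reach \<open>t1\<close> only with full speed. The velocity
  is then constant, so that the velocity read off at a rational time \<open>s < t1\<close> predicts \<open>W\<close> on
  \<open>(s, t1]\<close>. The assumption \<open>unpredictable\<close> excludes this; it concerns countably many times \<open>s\<close>
  only, so that exceptional null sets, one for each \<open>s\<close>, can be united.\<close>

lemma unpredictable_path_no_displacement:
  fixes D g :: "nat \<Rightarrow> real \<Rightarrow> real"
  assumes g: "\<And>c. set_integrable lborel {0..T} (g c)"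
    and D: "\<And>c t. t \<in> {0..T} \<Longrightarrow> D c t = (LINT u:{0..t}|lborel. g c u)"
    and drift: "AE u in lborel. u \<in> {0..T} \<longrightarrow>
      (\<forall>c. g c u = (if foreseen u (\<lambda>c. D c u / u) (W u) then D c u / u else 0))"
    and unpredictable: "\<And>s. s \<in> \<rat> \<Longrightarrow> 0 < s \<Longrightarrow> s < T \<Longrightarrow>
      AE r in lborel. r \<in> {s<..T} \<longrightarrow> path_value (\<lambda>n. D (Suc n) s / s) r \<noteq> W r"
    and t: "t \<in> {0..T}"
  shows "D c t = 0"
proof -
  let ?F = "\<lambda>u. foreseen u (\<lambda>c. D c u / u) (W u)"
  have never: "\<not> ?F t1" if t1: "t1 \<in> {0..T}" for t1
  proof
    assume F: "?F t1"
    then have one: "D 0 t1 / t1 = 1"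
      by (simp add: foreseen_def)
    then have "t1 \<noteq> 0" by auto
    with one t1 have D1: "D 0 t1 = t1" and pos: "0 < t1" by auto
    have gt: "set_integrable lborel {0..t1} (g c)" for c
      using t1 by (intro set_integrable_subset[OF g]) auto
    \<comment> \<open>The speed deficit of channel 0 is nonnegative and integrates to \<open>t1 - t1 = 0\<close>.\<close>
    let ?h = "\<lambda>u. indicator {0..t1} u *\<^sub>R 1 - indicator {0..t1} u *\<^sub>R g 0 u :: real"
    have hi: "integrable lborel ?h"
      using gt[of 0] unfolding set_integrable_def
      by (intro Bochner_Integration.integrable_diff) (auto simp: integrable_indicator_Icc)
    have "AE u in lborel. 0 \<le> ?h u"
      using drift
    proof eventually_elim
      case (elim u)
      then have "u \<in> {0..t1} \<Longrightarrow> g 0 u = (if ?F u then 1 else 0)"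
        using t1 by (simp add: foreseen_def)
      then show ?case by (cases "u \<in> {0..t1}") auto
    qed
    moreover have "integral\<^sup>L lborel ?h = 0"
    proof -
      have "integral\<^sup>L lborel ?h = (LINT u:{0..t1}|lborel. 1) - (LINT u:{0..t1}|lborel. g 0 u)"
        using gt[of 0] unfolding set_integrable_def set_lebesgue_integral_def
        by (intro Bochner_Integration.integral_diff) (auto simp: integrable_indicator_Icc)
      also have "(LINT u:{0..t1}|lborel. 1) = t1"
        using pos by (simp add: set_lebesgue_integral_def)
      finally show ?thesis using D[OF t1, of 0] D1 by simp
    qed
    ultimately have "AE u in lborel. ?h u = 0"
      using integral_nonneg_eq_0_iff_AE[OF hi] by simp
    with drift have active: "AE u in lborel. u \<in> {0..t1} \<longrightarrow> ?F u \<and> (\<forall>c. g c u = D c u / u)"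
    proof eventually_elim
      case (elim u)
      show ?case
      proof
        assume u: "u \<in> {0..t1}"
        then have gu: "g c u = (if ?F u then D c u / u else 0)" for c
          using elim t1 by auto
        moreover have "g 0 u = 1"
          using elim u by simp
        ultimately have "?F u" by (metis zero_neq_one)
        with gu show "?F u \<and> (\<forall>c. g c u = D c u / u)" by simp
      qed
    qed
    obtain s where s: "s \<in> \<rat>" "0 < s" "s < t1"
      using Rats_dense_in_real[OF pos] by auto
    have const: "D c u / u = D c s / s" if "u \<in> {s..t1}" for c u
    proof (rule constant_velocity[OF gt])
      show "AE u in lborel. u \<in> {0..t1} \<longrightarrow> g c u = D c u / u"
        using active by eventually_elim auto
    qed (use D t1 s that in auto)
    have "s < T" using s t1 by simp
    have "AE r in lborel. r \<notin> {s<..t1}"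
      using active unpredictable[OF s(1,2) \<open>s < T\<close>]
    proof eventually_elim
      case (elim r)
      show ?case
      proof
        assume r: "r \<in> {s<..t1}"
        then have "?F r" using elim s by auto
        then have "path_value (\<lambda>n. D (Suc n) s / s) r = W r"
          using const[of r] r by (simp add: foreseen_def)
        then show False using elim r t1 by auto
      qed
    qed
    then have "emeasure lborel {s<..t1} = 0"
      by (simp add: AE_iff_measurable[of "{s<..t1}"] greaterThanAtMost_def greaterThan_def atMost_def Collect_conj_eq)
    then show False using s by simp
  qed
  have "AE u in lborel. indicator {0..t} u *\<^sub>R g c u = 0"
    using drift
  proof eventually_elim
    case (elim u)
    then have "u \<in> {0..t} \<Longrightarrow> g c u = 0"
      using never[of u] t by simp
    then show ?case by (cases "u \<in> {0..t}") auto
  qed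
  then have "(LINT u:{0..t}|lborel. g c u) = 0"
    unfolding set_lebesgue_integral_def by (rule integral_eq_zero_AE)
  then show ?thesis using D[OF t] by simp
qed

text \<open>The same for a solution of the equation along a trajectory \<open>\<beta>\<close>. All copies of a channel
  receive the drift of copy 0 up to the factor \<open>2\<^sup>l\<close>, so the displacement of copy 0 is what the
  reading shows.\<close>

lemma unpredictable_trajectory_no_drift:
  assumes t: "t \<in> {0..1}" and sol: "\<And>u. u \<in> {0..t} \<Longrightarrow> integral_eq_at clairvoyant_drift \<beta> x u"
    and noise: "AE s in lborel. s \<in> {0..1} \<longrightarrow> negligible_noise (\<beta> s)"
    and unpredictable: "\<And>s. s \<in> \<rat> \<Longrightarrow> 0 < s \<Longrightarrow> s < t \<Longrightarrow> AE r in lborel. r \<in> {s<..1} \<longrightarrow>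
      path_value (\<lambda>n. (x s (channel (Suc n) 0) - \<beta> s (channel (Suc n) 0)) / s) r \<noteq> \<beta> r 0"
  shows "x t = \<beta> t"
proof -
  define g where "g c u = clairvoyant_drift (u, x u) (channel c 0)" for c u
  define D where "D c u = x u (channel c 0) - \<beta> u (channel c 0)" for c u
  have copies: "clairvoyant_drift (u, x u) (channel c l) = 2 ^ l * g c u" for c l u
    by (simp add: g_def clairvoyant_drift_channel)
  have int: "set_integrable lborel {0..t} (g c)" for c
    using sol[of t] t by (simp add: integral_eq_at_def g_def[abs_def])
  have DI: "D c u = (LINT s:{0..u}|lborel. g c s)" if "u \<in> {0..t}" for c u
    using sol[OF that] by (simp add: integral_eq_at_def g_def D_def)
  have x_channel: "x u (channel c l) = \<beta> u (channel c l) + 2 ^ l * D c u" if "u \<in> {0..t}" for u c l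
    using sol[OF that] DI[OF that] by (simp add: integral_eq_at_def copies)
  have x_0: "x u 0 = \<beta> u 0" if "u \<in> {0..t}" for u
    using sol[OF that] by (simp add: integral_eq_at_def)
  have "D c t = 0" for c
  proof (rule unpredictable_path_no_displacement[OF int DI])
    show "AE u in lborel. u \<in> {0..t} \<longrightarrow>
        (\<forall>c. g c u = (if foreseen u (\<lambda>c. D c u / u) (\<beta> u 0) then D c u / u else 0))"
      using noise
    proof eventually_elim
      case (elim u)
      show ?case
      proof (intro impI allI)
        fix c assume u: "u \<in> {0..t}"
        then have "reading (x u) = (\<lambda>c. D c u)"
          using elim t by (intro reading_displaced[where y = "\<beta> u"] x_channel) auto
        then have "velocity u (x u) = (\<lambda>c. D c u / u)"
          by (simp add: velocity_def fun_eq_iff)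
        then show "g c u = (if foreseen u (\<lambda>c. D c u / u) (\<beta> u 0) then D c u / u else 0)"
          by (simp add: g_def clairvoyant_drift_channel x_0[OF u])
      qed
    qed
    show "AE r in lborel. r \<in> {s<..t} \<longrightarrow> path_value (\<lambda>n. D (Suc n) s / s) r \<noteq> \<beta> r 0"
      if "s \<in> \<rat>" "0 < s" "s < t" for s
      using unpredictable[OF that] by eventually_elim (use t in \<open>auto simp: D_def\<close>)
  qed (use t in auto)
  then show ?thesis
    using x_0[of t] x_channel[of t] t by (intro rseq_eqI) auto
qed

section \<open>Brownian motion\<close>

text \<open>Time is clamped to [0,1], which avoids product spaces over restricted measures. The process is
  the pointwise limit of its values at dyadic times.\<close>

lemma measurable_continuous_process:
  fixes W :: "real \<Rightarrow> 'a \<Rightarrow> real"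
  assumes W: "\<And>t. t \<in> {0..1} \<Longrightarrow> W t \<in> borel_measurable M"
    and cont: "\<And>\<omega>. \<omega> \<in> space M \<Longrightarrow> continuous_on {0..1} (\<lambda>t. W t \<omega>)"
  shows "(\<lambda>z. W (max 0 (min 1 (snd z))) (fst z)) \<in> borel_measurable (M \<Otimes>\<^sub>M lborel)"
proof (rule borel_measurable_LIMSEQ_metric)
  let ?clamp = "\<lambda>t::real. max 0 (min 1 t)"
  let ?grid = "\<lambda>k (t::real). ?clamp (of_int \<lfloor>t * 2 ^ k\<rfloor> / 2 ^ k)"
  show "(\<lambda>z. W (?grid k (snd z)) (fst z)) \<in> borel_measurable (M \<Otimes>\<^sub>M lborel)" for k
  proof (rule measurable_compose_countable[where f = "\<lambda>i z. W (?clamp (of_int i / 2 ^ k)) (fst z)"])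
    show "(\<lambda>z. W (?clamp (of_int i / 2 ^ k)) (fst z)) \<in> borel_measurable (M \<Otimes>\<^sub>M lborel)" for i
      by (rule measurable_compose[OF measurable_fst W]) auto
    show "(\<lambda>z. \<lfloor>snd z * (2::real) ^ k\<rfloor>) \<in> measurable (M \<Otimes>\<^sub>M lborel) (count_space UNIV)"
      by measurable
  qed
  show "(\<lambda>k. W (?grid k (snd z)) (fst z)) \<longlonglongrightarrow> W (?clamp (snd z)) (fst z)"
    if "z \<in> space (M \<Otimes>\<^sub>M lborel)" for z
  proof (rule continuous_on_tendsto_compose[OF cont])
    show "fst z \<in> space M" using that by (auto simp: space_pair_measure)
    show "(\<lambda>k. ?grid k (snd z)) \<longlonglongrightarrow> ?clamp (snd z)"
      by (intro tendsto_max tendsto_min tendsto_const dyadic_floor_tendsto)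
  qed auto
qed

text \<open>Fubini exchanges the quantifiers over sample points and over times.\<close>

lemma AE_all_times:
  assumes "prob_space M"
    and P: "Measurable.pred (M \<Otimes>\<^sub>M lborel) (\<lambda>z. P (fst z) (max 0 (min 1 (snd z))))"
    and T: "T \<in> sets lborel" "T \<subseteq> {0..1}"
    and ae: "\<And>t. t \<in> T \<Longrightarrow> AE \<omega> in M. P \<omega> t"
  shows "AE \<omega> in M. AE t in lborel. t \<in> T \<longrightarrow> P \<omega> (t::real)"
proof -
  interpret M: prob_space M by fact
  interpret pair_sigma_finite M lborel ..
  let ?Q = "\<lambda>\<omega> t. t \<in> T \<longrightarrow> P \<omega> (max 0 (min 1 t))"
  have clamp: "max 0 (min 1 t) = t" if "t \<in> T" for t
    using that T by auto
  have "{z \<in> space (M \<Otimes>\<^sub>M lborel). ?Q (fst z) (snd z)} \<in> sets (M \<Otimes>\<^sub>M lborel)"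
    using P T(1) by measurable
  then have "(AE \<omega> in M. AE t in lborel. ?Q \<omega> t) \<longleftrightarrow> (AE t in lborel. AE \<omega> in M. ?Q \<omega> t)"
    by (rule AE_commute)
  moreover have "AE t in lborel. AE \<omega> in M. ?Q \<omega> t"
  proof (rule AE_I2)
    show "AE \<omega> in M. ?Q \<omega> t" for t
      using ae[of t] clamp[of t] by (cases "t \<in> T") auto
  qed
  moreover have "?Q \<omega> t \<longleftrightarrow> (t \<in> T \<longrightarrow> P \<omega> t)" for \<omega> t
    using clamp by auto
  ultimately show ?thesis by simp
qed

text \<open>Countable quantifiers make measurability evident.\<close>

lemma negligible_noise_iff:
  "negligible_noise y \<longleftrightarrow> (\<forall>c n. \<exists>L. \<forall>l\<ge>L. \<bar>y (channel c l) / 2 ^ l\<bar> < inverse (real (Suc n)))"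
proof -
  have "X \<longlonglongrightarrow> 0 \<longleftrightarrow> (\<forall>n. \<exists>L. \<forall>l\<ge>L. \<bar>X l\<bar> < inverse (real (Suc n)))" for X :: "nat \<Rightarrow> real"
  proof
    show "\<forall>n. \<exists>L. \<forall>l\<ge>L. \<bar>X l\<bar> < inverse (real (Suc n))" if "X \<longlonglongrightarrow> 0"
      using LIMSEQ_D[OF that, of "inverse (real (Suc n))" for n] by simp
  next
    assume *: "\<forall>n. \<exists>L. \<forall>l\<ge>L. \<bar>X l\<bar> < inverse (real (Suc n))"
    show "X \<longlonglongrightarrow> 0"
    proof (rule LIMSEQ_I)
      fix e :: real assume "0 < e"
      then obtain n where "inverse (real (Suc n)) < e" using reals_Archimedean by blast
      with * show "\<exists>L. \<forall>l\<ge>L. norm (X l - 0) < e" by (metis less_trans real_norm_def diff_zero)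
    qed
  qed
  then show ?thesis by (auto simp: negligible_noise_def)
qed

lemma pred_negligible_noise:
  assumes "\<And>i. (\<lambda>z. Y z i) \<in> borel_measurable N"
  shows "Measurable.pred N (\<lambda>z. negligible_noise (Y z))"
  using assms unfolding negligible_noise_iff by measurable

lemma cylindrical_bm_coordinate:
  "cylindrical_bm M B \<Longrightarrow> standard_bm M (\<lambda>t \<omega>. B t \<omega> i)"
  by (simp add: cylindrical_bm_def)

lemma cylindrical_bm_measurable:
  "cylindrical_bm M B \<Longrightarrow> 0 \<le> t \<Longrightarrow> (\<lambda>\<omega>. B t \<omega> i) \<in> borel_measurable M"
  using cylindrical_bm_coordinate[of M B i] by (simp add: standard_bm_def)

lemma cylindrical_bm_continuous:
  assumes "cylindrical_bm M B" "\<omega> \<in> space M"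
  shows "continuous_on {0..1} (\<lambda>t. B t \<omega> i)"
proof (rule continuous_on_subset)
  show "continuous_on {0..} (\<lambda>t. B t \<omega> i)"
    using cylindrical_bm_coordinate[OF assms(1)] assms(2) by (simp add: standard_bm_def)
qed auto

lemma cylindrical_bm_zero:
  assumes "cylindrical_bm M B"
  shows "AE \<omega> in M. B 0 \<omega> = (\<lambda>_. 0)"
proof -
  have "AE \<omega> in M. \<forall>i. B 0 \<omega> i = 0"
    using cylindrical_bm_coordinate[OF assms] by (simp add: standard_bm_def AE_all_countable)
  then show ?thesis by (simp add: fun_eq_iff)
qed

lemma measurable_trajectory_path_space:
  assumes B: "cylindrical_bm M B"
  shows "(\<lambda>\<omega>. \<lambda>t\<in>{0..1}. B t \<omega>) \<in> measurable M path_space"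
  unfolding path_space_def
proof (rule measurable_restrict_space2)
  show "(\<lambda>\<omega>. \<lambda>t\<in>{0..1}. B t \<omega>) \<in> measurable M (Pi\<^sub>M {0..1} (\<lambda>_. borel))"
    by (intro measurable_restrict measurable_coordinatewise_then_product cylindrical_bm_measurable[OF B]) auto
  show "(\<lambda>\<omega>. \<lambda>t\<in>{0..1}. B t \<omega>) \<in> space M \<rightarrow> {w. continuous_on {0..1} w}"
  proof (intro Pi_I CollectI)
    fix \<omega> assume "\<omega> \<in> space M"
    then have "continuous_on {0..1} (\<lambda>t. B t \<omega>)"
      unfolding continuous_on_rseq_iff using cylindrical_bm_continuous[OF B] by simp
    then show "continuous_on {0..1} (\<lambda>t\<in>{0..1}. B t \<omega>)"
      by (rule continuous_on_eq) simp
  qed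
qed

lemma cylindrical_bm_increment:
  "cylindrical_bm M B \<Longrightarrow> 0 \<le> s \<Longrightarrow> s < t \<Longrightarrow>
    distributed M lborel (\<lambda>\<omega>. B t \<omega> i - B s \<omega> i) (normal_density 0 (sqrt (t - s)))"
  using cylindrical_bm_coordinate[of M B i] by (simp add: standard_bm_def)

text \<open>The expectation of \<open>\<Sum>l. \<bar>Y l\<bar> / 2 ^ l\<close> is at most \<open>2 * K\<close>, so the series converges almost surely.\<close>

lemma AE_bounded_mean_tendsto_0:
  fixes Y :: "nat \<Rightarrow> 'a \<Rightarrow> real"
  assumes "\<And>l. integrable M (Y l)" and "\<And>l. (\<integral>\<omega>. \<bar>Y l \<omega>\<bar> \<partial>M) \<le> K"
  shows "AE \<omega> in M. (\<lambda>l. Y l \<omega> / 2 ^ l) \<longlonglongrightarrow> 0"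
proof -
  have [measurable]: "Y l \<in> borel_measurable M" for l
    using assms(1) by auto
  let ?Z = "\<lambda>l \<omega>. ennreal \<bar>Y l \<omega> / 2 ^ l\<bar>"
  have K: "0 \<le> K"
    using assms(2)[of 0] by (rule order_trans[rotated]) simp
  have "(\<integral>\<^sup>+\<omega>. (\<Sum>l. ?Z l \<omega>) \<partial>M) = (\<Sum>l. \<integral>\<^sup>+\<omega>. ?Z l \<omega> \<partial>M)"
    by (rule nn_integral_suminf) measurable
  also have "\<dots> \<le> (\<Sum>l. ennreal (K * (1 / 2) ^ l))"
  proof (intro suminf_le summableI)
    fix l
    have "(\<integral>\<^sup>+\<omega>. ?Z l \<omega> \<partial>M) = ennreal (\<integral>\<omega>. \<bar>Y l \<omega> / 2 ^ l\<bar> \<partial>M)"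
      using assms(1) by (intro nn_integral_eq_integral) auto
    also have "(\<integral>\<omega>. \<bar>Y l \<omega> / 2 ^ l\<bar> \<partial>M) = (\<integral>\<omega>. \<bar>Y l \<omega>\<bar> \<partial>M) * (1 / 2) ^ l"
      by (simp add: power_one_over)
    also have "ennreal \<dots> \<le> ennreal (K * (1 / 2) ^ l)"
      using assms(2) by (intro ennreal_leI mult_right_mono) auto
    finally show "(\<integral>\<^sup>+\<omega>. ?Z l \<omega> \<partial>M) \<le> ennreal (K * (1 / 2) ^ l)" .
  qed
  also have "\<dots> < \<infinity>"
  proof -
    have "summable (\<lambda>l. K * (1 / 2) ^ l)" by (intro summable_mult summable_geometric) auto
    then show ?thesis using K by (subst suminf_ennreal2) auto
  qed
  finally have "AE \<omega> in M. (\<Sum>l. ?Z l \<omega>) \<noteq> \<infinity>"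
    by (intro nn_integral_noteq_infinite) auto
  then show ?thesis
  proof eventually_elim
    case (elim \<omega>)
    then have "summable (\<lambda>l. \<bar>Y l \<omega> / 2 ^ l\<bar>)"
      by (intro summable_suminf_not_top) auto
    then show ?case
      by (rule summable_LIMSEQ_zero[OF summable_rabs_cancel])
  qed
qed

lemma cylindrical_bm_negligible_noise:
  assumes B: "cylindrical_bm M B" and t: "0 \<le> t"
  shows "AE \<omega> in M. negligible_noise (B t \<omega>)"
proof (cases "t = 0")
  case True
  show ?thesis
    using cylindrical_bm_zero[OF B] by eventually_elim (simp add: True negligible_noise_def)
next
  case False
  with t have t: "0 < t" by simp
  define p where "p = normal_density 0 (sqrt t)"
  have dist: "distributed M lborel (\<lambda>\<omega>. B t \<omega> i - B 0 \<omega> i) p" for i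
    using cylindrical_bm_increment[OF B _ t] by (simp add: p_def)
  have p0: "0 \<le> p x" for x by (simp add: p_def)
  have "integrable lborel (\<lambda>x. p x * \<bar>x\<bar>)"
    using integrable_normal_moment_abs[of "sqrt t" 0 1] t by (simp add: p_def)
  then have int: "integrable M (\<lambda>\<omega>. \<bar>B t \<omega> i - B 0 \<omega> i\<bar>)" for i
    using distributed_integrable[OF dist, of "\<lambda>x. \<bar>x\<bar>"] p0 by simp
  have eq: "(\<integral>\<omega>. \<bar>B t \<omega> i - B 0 \<omega> i\<bar> \<partial>M) = (\<integral>x. p x * \<bar>x\<bar> \<partial>lborel)" for i
    using distributed_integral[OF dist, of "\<lambda>x. \<bar>x\<bar>"] p0 by simp
  have meas: "(\<lambda>\<omega>. B t \<omega> i - B 0 \<omega> i) \<in> borel_measurable M" for i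
    using cylindrical_bm_measurable[OF B] t by (intro borel_measurable_diff) auto
  have "AE \<omega> in M. (\<lambda>l. (B t \<omega> (channel c l) - B 0 \<omega> (channel c l)) / 2 ^ l) \<longlonglongrightarrow> 0" for c
  proof (rule AE_bounded_mean_tendsto_0)
    show "integrable M (\<lambda>\<omega>. B t \<omega> (channel c l) - B 0 \<omega> (channel c l))" for l
      by (rule integrable_abs_cancel[OF int meas])
  qed (rule eq[THEN eq_refl])
  then have "AE \<omega> in M. \<forall>c. (\<lambda>l. (B t \<omega> (channel c l) - B 0 \<omega> (channel c l)) / 2 ^ l) \<longlonglongrightarrow> 0"
    by (simp add: AE_all_countable)
  with cylindrical_bm_zero[OF B] show ?thesis
    by eventually_elim (simp add: negligible_noise_def)
qed

lemma cylindrical_bm_negligible_noise_all_times: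
  assumes M: "prob_space M" and B: "cylindrical_bm M B"
  shows "AE \<omega> in M. AE t in lborel. t \<in> {0..1} \<longrightarrow> negligible_noise (B t \<omega>)"
proof (rule AE_all_times[OF M])
  show "Measurable.pred (M \<Otimes>\<^sub>M lborel) (\<lambda>z. negligible_noise (B (max 0 (min 1 (snd z))) (fst z)))"
    using cylindrical_bm_measurable[OF B] cylindrical_bm_continuous[OF B]
    by (intro pred_negligible_noise measurable_continuous_process) auto
qed (use cylindrical_bm_negligible_noise[OF B] in auto)

section \<open>Adapted predictions fail\<close>

text \<open>The joint law of independent variables is the product of their laws, and the diagonal is null
  for a product whose second factor has a density.\<close>

lemma (in prob_space) indep_var_continuous_neq:
  fixes U V :: "'a \<Rightarrow> real"
  assumes UV: "indep_var borel U borel V" and V: "distributed M lborel V f"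
  shows "AE \<omega> in M. U \<omega> \<noteq> V \<omega>"
proof -
  have [measurable]: "U \<in> borel_measurable M" "V \<in> borel_measurable M"
    using UV by (auto dest: indep_var_rv1 indep_var_rv2)
  have joint: "distr M borel U \<Otimes>\<^sub>M distr M borel V = distr M (borel \<Otimes>\<^sub>M borel) (\<lambda>\<omega>. (U \<omega>, V \<omega>))"
    using UV unfolding indep_var_distribution_eq by simp
  interpret U: prob_space "distr M borel U" by (rule prob_space_distr) measurable
  interpret V: prob_space "distr M borel V" by (rule prob_space_distr) measurable
  interpret pair_prob_space "distr M borel U" "distr M borel V" ..
  have [measurable]: "f \<in> borel_measurable lborel"
    using V by (rule distributed_borel_measurable)
  have "AE v in lborel. f v \<noteq> 0 \<longrightarrow> u \<noteq> v" for u
    using AE_lborel_singleton[of u] by eventually_elim auto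
  then have "AE v in distr M lborel V. u \<noteq> v" for u
    unfolding distributed_distr_eq_density[OF V] by (subst AE_density) (auto simp: zero_less_iff_neq_zero)
  then have "AE v in distr M borel V. u \<noteq> v" for u
    unfolding distr_cong[OF refl sets_lborel[symmetric] refl, of M V] .
  then have "AE u in distr M borel U. AE v in distr M borel V. u \<noteq> v"
    by simp
  moreover have diagonal: "{z \<in> space (distr M borel U \<Otimes>\<^sub>M distr M borel V). fst z \<noteq> snd z}
      \<in> sets (distr M borel U \<Otimes>\<^sub>M distr M borel V)"
    by measurable
  ultimately have "AE z in distr M borel U \<Otimes>\<^sub>M distr M borel V. fst z \<noteq> snd z"
    by (subst (asm) AE_pair_iff[OF diagonal])
  then have "AE z in distr M (borel \<Otimes>\<^sub>M borel) (\<lambda>\<omega>. (U \<omega>, V \<omega>)). fst z \<noteq> snd z"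
    unfolding joint .
  then show ?thesis
    by (subst (asm) AE_distr_iff) auto
qed

text \<open>Subtract \<open>B s\<close> on both sides: \<open>U - B s\<close> belongs to the past at time \<open>s\<close>, and the increment
  \<open>B r - B s\<close> is independent of that past and has a Gaussian density.\<close>

lemma brownian_basis_unpredictable:
  fixes U :: "'a \<Rightarrow> real"
  assumes basis: "brownian_basis M F B" and s: "0 \<le> s" "s < r"
    and U: "U \<in> borel_measurable (F (ennreal s))"
  shows "AE \<omega> in M. U \<omega> \<noteq> B r \<omega> i"
proof -
  from basis interpret prob_space M by (simp add: brownian_basis_def)
  let ?F = "F (ennreal s)"
  let ?U = "\<lambda>\<omega>. U \<omega> - B s \<omega> i" and ?V = "\<lambda>\<omega>. B r \<omega> i - B s \<omega> i"
  have B: "cylindrical_bm M B" and sub: "sets ?F \<subseteq> events" and sp: "space ?F = space M"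
    and Bs: "B s \<in> borel_measurable ?F"
    using basis s by (auto simp: brownian_basis_def filtration_def)
  have ind: "indep_set (sets ?F) {(\<lambda>\<omega> i. B r \<omega> i - B s \<omega> i) -` A \<inter> space M | A. A \<in> sets borel}"
    using basis s by (auto simp: brownian_basis_def)
  have U': "?U \<in> borel_measurable ?F"
    by (intro borel_measurable_diff U measurable_compose[OF Bs measurable_product_coordinates])
  have V: "distributed M lborel ?V (normal_density 0 (sqrt (r - s)))"
    using s by (intro cylindrical_bm_increment[OF B])
  have Vm: "?V \<in> borel_measurable M"
    using distributed_measurable[OF V] by simp
  have "indep_set {?U -` A \<inter> space M | A. A \<in> sets borel} {?V -` A \<inter> space M | A. A \<in> sets borel}"
  proof (rule indep_setI)
    have U_past: "{?U -` A \<inter> space M | A. A \<in> sets borel} \<subseteq> sets ?F"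
      using measurable_sets[OF U'] sp by auto
    then show "{?U -` A \<inter> space M | A. A \<in> sets borel} \<subseteq> events"
      using sub by (rule order_trans)
    show "{?V -` A \<inter> space M | A. A \<in> sets borel} \<subseteq> events"
      using measurable_sets[OF Vm] by auto
    fix a b
    assume a: "a \<in> {?U -` A \<inter> space M | A. A \<in> sets borel}"
      and "b \<in> {?V -` A \<inter> space M | A. A \<in> sets borel}"
    then obtain A where A: "A \<in> sets borel" "b = ?V -` A \<inter> space M" by auto
    have "{y :: rseq. y i \<in> A} \<in> sets borel"
      using measurable_sets[OF measurable_product_coordinates A(1), of i] by (simp add: vimage_def)
    moreover have "b = (\<lambda>\<omega> i. B r \<omega> i - B s \<omega> i) -` {y. y i \<in> A} \<inter> space M"
      using A(2) by auto
    ultimately have "b \<in> {(\<lambda>\<omega> i. B r \<omega> i - B s \<omega> i) -` A \<inter> space M | A. A \<in> sets borel}"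
      by blast
    then show "prob (a \<inter> b) = prob a * prob b"
      using indep_setD[OF ind] a U_past by blast
  qed
  moreover have stable: "Int_stable {Z -` A \<inter> space M | A. A \<in> sets borel}" for Z :: "'a \<Rightarrow> real"
  proof (safe intro!: Int_stableI)
    fix A A' :: "real set" assume "A \<in> sets borel" "A' \<in> sets borel"
    then show "\<exists>C. (Z -` A \<inter> space M) \<inter> (Z -` A' \<inter> space M) = Z -` C \<inter> space M \<and> C \<in> sets borel"
      by (intro exI[of _ "A \<inter> A'"]) auto
  qed
  moreover have "?U \<in> borel_measurable M"
    by (rule measurable_from_subalg[OF _ U']) (use sub sp in \<open>simp add: subalgebra_def\<close>)
  ultimately have "indep_var borel ?U borel ?V"
    unfolding indep_var_eq using Vm by (blast intro: indep_set_sigma_sets)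
  then have "AE \<omega> in M. ?U \<omega> \<noteq> ?V \<omega>"
    using V by (rule indep_var_continuous_neq)
  then show ?thesis by eventually_elim auto
qed

lemma brownian_basis_path_value_wrong:
  assumes basis: "brownian_basis M F B" and s: "0 \<le> s"
    and m: "\<And>n. (\<lambda>\<omega>. m \<omega> n) \<in> borel_measurable (F (ennreal s))"
  shows "AE \<omega> in M. AE r in lborel. r \<in> {s<..1} \<longrightarrow> path_value (m \<omega>) r \<noteq> B r \<omega> i"
proof (rule AE_all_times)
  show "prob_space M"
    using basis by (simp add: brownian_basis_def)
  have B: "cylindrical_bm M B"
    using basis by (simp add: brownian_basis_def)
  have "subalgebra M (F (ennreal s))"
    using basis by (auto simp: brownian_basis_def filtration_def subalgebra_def)
  then have mM: "(\<lambda>\<omega>. m \<omega> n) \<in> borel_measurable M" for n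
    using m by (rule measurable_from_subalg)
  have "(\<lambda>z. path_value (m (fst z)) (max 0 (min 1 (snd z)))) \<in> borel_measurable (M \<Otimes>\<^sub>M lborel)"
    by (rule measurable_path_value[OF measurable_compose[OF measurable_fst mM]]) measurable
  moreover have "(\<lambda>z. B (max 0 (min 1 (snd z))) (fst z) i) \<in> borel_measurable (M \<Otimes>\<^sub>M lborel)"
    using cylindrical_bm_measurable[OF B] cylindrical_bm_continuous[OF B]
    by (intro measurable_continuous_process) auto
  ultimately show "Measurable.pred (M \<Otimes>\<^sub>M lborel)
      (\<lambda>z. path_value (m (fst z)) (max 0 (min 1 (snd z))) \<noteq> B (max 0 (min 1 (snd z))) (fst z) i)"
    by measurable
  show "{s<..1} \<in> sets lborel" "{s<..1} \<subseteq> {0..1}"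
    using s by auto
  show "AE \<omega> in M. path_value (m \<omega>) r \<noteq> B r \<omega> i" if "r \<in> {s<..1}" for r
    using that by (intro brownian_basis_unpredictable[OF basis s] measurable_path_value m) auto
qed

section \<open>The counterexample\<close>

text \<open>Adaptedness enters here: the velocity \<open>(X s - B s) / s\<close> of copy 0 of each channel is known at
  time \<open>s\<close>, and hence fails to predict the undisturbed coordinate after \<open>s\<close>.\<close>

lemma weak_solution_coincides_with_noise:
  assumes basis: "brownian_basis M F B"
    and X: "weak_solution_upto clairvoyant_drift M F B \<tau> X"
  shows "coincide_upto M \<tau> X B"
proof -
  have M: "prob_space M" and B: "cylindrical_bm M B"
    and Bt: "\<And>t. 0 \<le> t \<Longrightarrow> B t \<in> borel_measurable (F (ennreal t))"
    using basis by (auto simp: brownian_basis_def)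
  have Xt: "X t \<in> borel_measurable (F (ennreal t))" if "t \<in> {0..1}" for t
    using X that by (simp add: weak_solution_upto_def)
  have eq: "AE \<omega> in M. \<forall>t\<in>{0..1}. ennreal t \<le> \<tau> \<omega> \<longrightarrow>
      integral_eq_at clairvoyant_drift (\<lambda>s. B s \<omega>) (\<lambda>s. X s \<omega>) t"
    using X by (auto simp: weak_solution_upto_def)
  let ?m = "\<lambda>s \<omega> n. (X s \<omega> (channel (Suc n) 0) - B s \<omega> (channel (Suc n) 0)) / s"
  have "AE \<omega> in M. AE r in lborel. r \<in> {s<..1} \<longrightarrow> path_value (?m s \<omega>) r \<noteq> B r \<omega> 0"
    if "s \<in> {0..1}" for s
  proof (rule brownian_basis_path_value_wrong[OF basis])
    show "(\<lambda>\<omega>. ?m s \<omega> n) \<in> borel_measurable (F (ennreal s))" for n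
      using that
      by (intro borel_measurable_divide borel_measurable_diff borel_measurable_const
          measurable_compose[OF Xt measurable_product_coordinates]
          measurable_compose[OF Bt measurable_product_coordinates]) auto
  qed (use that in auto)
  then have "AE \<omega> in M. \<forall>s\<in>\<rat> \<inter> {0..1}. AE r in lborel.
      r \<in> {s<..1} \<longrightarrow> path_value (?m s \<omega>) r \<noteq> B r \<omega> 0"
    by (subst AE_ball_countable) (auto simp: countable_rat)
  with eq cylindrical_bm_negligible_noise_all_times[OF M B] show ?thesis
    unfolding coincide_upto_def
  proof eventually_elim
    case (elim \<omega>)
    show ?case
    proof (intro ballI impI)
      fix t :: real assume t: "t \<in> {0..1}" "ennreal t \<le> \<tau> \<omega>"
      show "X t \<omega> = B t \<omega>"
      proof (rule unpredictable_trajectory_no_drift[OF t(1)])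
        fix u assume u: "u \<in> {0..t}"
        then have "ennreal u \<le> \<tau> \<omega>"
          using t(2) by (meson atLeastAtMost_iff ennreal_leI order_trans)
        then show "integral_eq_at clairvoyant_drift (\<lambda>s. B s \<omega>) (\<lambda>s. X s \<omega>) u"
          using elim(1) u t(1) by auto
      qed (use elim(2,3) t(1) in auto)
    qed
  qed
qed

lemma noise_is_weak_solution:
  assumes basis: "brownian_basis M F B"
  shows "weak_solution_upto clairvoyant_drift M F B \<tau> B"
proof -
  have M: "prob_space M" and B: "cylindrical_bm M B"
    using basis by (auto simp: brownian_basis_def)
  have cont: "continuous_on {0..1} (\<lambda>t. B t \<omega>)" if "\<omega> \<in> space M" for \<omega>
    unfolding continuous_on_rseq_iff using cylindrical_bm_continuous[OF B that] by (rule allI)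
  have "AE \<omega> in M. \<omega> \<in> space M \<and> B 0 \<omega> = (\<lambda>_. 0) \<and> (AE t in lborel. t \<in> {0..1} \<longrightarrow> negligible_noise (B t \<omega>))"
    using AE_space cylindrical_bm_zero[OF B] cylindrical_bm_negligible_noise_all_times[OF M B]
    by eventually_elim auto
  then have "AE \<omega> in M. B 0 \<omega> = (\<lambda>_. 0) \<and> (\<forall>t\<in>{0..1}. ennreal t \<le> \<tau> \<omega> \<longrightarrow>
      integral_eq_at clairvoyant_drift (\<lambda>s. B s \<omega>) (\<lambda>s. B s \<omega>) t)"
    by eventually_elim (use cont trajectory_solves_own_equation in blast)
  then show ?thesis
    using basis cont by (auto simp: weak_solution_upto_def brownian_basis_def)
qed

lemma noise_is_strong: "strong_upto M B \<tau> B"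
  unfolding strong_upto_def
proof (intro exI conjI ballI)
  show "coincide_upto M \<tau> B B"
    by (simp add: coincide_upto_def)
  fix t :: real assume t: "t \<in> {0..1}"
  let ?G = "{B s -` A \<inter> space M | s A. s \<in> {0..t} \<and> A \<in> sets borel} \<union> null_sets M"
  have G: "?G \<subseteq> Pow (space M)"
    using sets.sets_into_space by auto
  have "B t -` A \<inter> space M \<in> ?G" if "A \<in> sets borel" for A
    using that t by auto
  then show "B t \<in> borel_measurable (completed_filtration M B t)"
    unfolding completed_filtration_def using G
    by (intro measurableI) (auto simp: space_measure_of_conv)
qed

lemma clairvoyant_drift_strong_well_posedness:
  "strong_well_posedness TYPE('a) clairvoyant_drift"
  unfolding strong_well_posedness_def
proof (intro allI impI)
  fix M :: "'a measure" and F B \<tau>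
  assume "brownian_basis M F B \<and> stopping_time F \<tau>"
  then have basis: "brownian_basis M F B" ..
  note eq = weak_solution_coincides_with_noise[OF basis]
  have "pathwise_unique_upto clairvoyant_drift M F B \<tau>"
    unfolding pathwise_unique_upto_def
  proof (intro allI impI)
    fix X Y
    assume "weak_solution_upto clairvoyant_drift M F B \<tau> X \<and> weak_solution_upto clairvoyant_drift M F B \<tau> Y"
    then have "coincide_upto M \<tau> X B" "coincide_upto M \<tau> Y B"
      using eq by auto
    then show "coincide_upto M \<tau> X Y"
      unfolding coincide_upto_def by eventually_elim auto
  qed
  then show "(\<exists>X. weak_solution_upto clairvoyant_drift M F B \<tau> X \<and>
             (\<forall>Y. weak_solution_upto clairvoyant_drift M F B \<tau> Y \<longrightarrow> coincide_upto M \<tau> Y X) \<and>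
             strong_upto M B \<tau> X) \<and> pathwise_unique_upto clairvoyant_drift M F B \<tau>"
    using noise_is_weak_solution[OF basis] noise_is_strong eq by blast
qed

lemma clairvoyant_drift_ode_nonuniqueness:
  "ode_nonuniqueness TYPE('a) clairvoyant_drift"
  unfolding ode_nonuniqueness_def
proof (intro allI impI)
  fix M :: "'a measure" and B
  assume "prob_space M \<and> cylindrical_bm M B"
  then have M: "prob_space M" and B: "cylindrical_bm M B" by auto
  let ?N = "\<lambda>\<beta>. AE t in lborel. t \<in> {0..1} \<longrightarrow> negligible_noise (\<beta> t)"
  define \<Omega> where "\<Omega> = {\<beta> \<in> space path_space. \<beta> 0 = (\<lambda>_. 0) \<and> ?N \<beta>}"
  show "\<exists>\<Omega>\<in>sets path_space. measure (path_law M B) \<Omega> = 1 \<and>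
           (\<forall>\<beta>\<in>\<Omega>. \<exists>x y. ode_solution clairvoyant_drift \<beta> x \<and> ode_solution clairvoyant_drift \<beta> y \<and>
                          (\<exists>t\<in>{0..1}. x t \<noteq> y t))"
  proof (intro bexI[of _ \<Omega>] conjI ballI)
    fix \<beta> assume "\<beta> \<in> \<Omega>"
    then show "\<exists>x y. ode_solution clairvoyant_drift \<beta> x \<and> ode_solution clairvoyant_drift \<beta> y \<and>
        (\<exists>t\<in>{0..1}. x t \<noteq> y t)"
      by (intro two_solutions) (auto simp: \<Omega>_def path_space_def space_restrict_space)
  next
    have eval: "(\<lambda>\<beta>. \<beta> t i) \<in> borel_measurable path_space" if "t \<in> {0..1}" for t i
      unfolding path_space_def
    proof (rule measurable_restrict_space1)
      have "(\<lambda>\<beta>. \<beta> t) \<in> borel_measurable (Pi\<^sub>M {0..1} (\<lambda>_. borel :: rseq measure))"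
        using that by (rule measurable_component_singleton)
      then show "(\<lambda>\<beta>. \<beta> t i) \<in> borel_measurable (Pi\<^sub>M {0..1} (\<lambda>_. borel :: rseq measure))"
        by (rule measurable_compose[OF _ measurable_product_coordinates])
    qed
    have cont: "continuous_on {0..1} (\<lambda>t. \<beta> t i)" if "\<beta> \<in> space path_space" for \<beta> i
    proof -
      have "continuous_on {0..1} \<beta>"
        using that by (simp add: path_space_def space_restrict_space)
      then show ?thesis unfolding continuous_on_rseq_iff by (rule spec)
    qed
    have pred: "Measurable.pred (path_space \<Otimes>\<^sub>M lborel)
        (\<lambda>z. snd z \<in> {0..1} \<longrightarrow> negligible_noise (fst z (max 0 (min 1 (snd z)))))" (is "Measurable.pred _ ?P")
    proof -
      have "Measurable.pred (path_space \<Otimes>\<^sub>M lborel) (\<lambda>z. negligible_noise (fst z (max 0 (min 1 (snd z)))))"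
        using eval cont
        by (intro pred_negligible_noise measurable_continuous_process[of "\<lambda>t \<beta>. \<beta> t i" for i]) auto
      then show ?thesis by measurable
    qed
    \<comment> \<open>The exceptional set of times of a path is a section of a measurable set, so its length depends
      measurably on the path.\<close>
    have "Measurable.pred path_space ?N"
    proof -
      let ?E = "{z \<in> space (path_space \<Otimes>\<^sub>M lborel). \<not> ?P z}"
      have E: "?E \<in> sets (path_space \<Otimes>\<^sub>M lborel)"
        using pred by measurable
      have "?N \<beta> \<longleftrightarrow> emeasure lborel (Pair \<beta> -` ?E) = 0" if "\<beta> \<in> space path_space" for \<beta>
      proof -
        have "Pair \<beta> -` ?E \<in> sets lborel"
          using E by (rule sets_Pair1)
        moreover have "Pair \<beta> -` ?E = {t \<in> space lborel. \<not> (t \<in> {0..1} \<longrightarrow> negligible_noise (\<beta> t))}"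
          using that by (auto simp: space_pair_measure)
        ultimately show ?thesis
          using AE_iff_measurable[of "Pair \<beta> -` ?E" lborel "\<lambda>t. t \<in> {0..1} \<longrightarrow> negligible_noise (\<beta> t)"] by simp
      qed
      moreover have "Measurable.pred path_space (\<lambda>\<beta>. emeasure lborel (Pair \<beta> -` ?E) = 0)"
        using lborel.measurable_emeasure_Pair[OF E] by measurable
      ultimately show ?thesis
        by (simp cong: measurable_cong)
    qed
    moreover have "Measurable.pred path_space (\<lambda>\<beta>. \<forall>i. \<beta> 0 i = 0)"
      using eval[of 0] by measurable
    ultimately show \<Omega>: "\<Omega> \<in> sets path_space"
      unfolding \<Omega>_def fun_eq_iff by measurable
    note path = measurable_trajectory_path_space[OF B]
    have "prob_space (path_law M B)"
      unfolding path_law_def by (rule prob_space.prob_space_distr[OF M path])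
    moreover have "AE \<beta> in path_law M B. \<beta> \<in> \<Omega>"
      unfolding path_law_def
    proof (subst AE_distr_iff[OF path])
      show "{\<beta> \<in> space path_space. \<beta> \<in> \<Omega>} \<in> sets path_space"
        using \<Omega> by measurable
      show "AE \<omega> in M. (\<lambda>t\<in>{0..1}. B t \<omega>) \<in> \<Omega>"
        using AE_space cylindrical_bm_zero[OF B] cylindrical_bm_negligible_noise_all_times[OF M B]
      proof eventually_elim
        case (elim \<omega>)
        have "?N (\<lambda>t\<in>{0..1}. B t \<omega>)"
          using elim(3) by eventually_elim auto
        then show ?case
          using elim(1,2) measurable_space[OF path] by (auto simp: \<Omega>_def)
      qed
    qed
    ultimately show "measure (path_law M B) \<Omega> = 1"
      using \<Omega> by (subst prob_space.prob_eq_1) (auto simp: path_law_def)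
  qed
qed

lemma clairvoyant_drift_counterexample: "counterexample_drift TYPE('a) clairvoyant_drift"
  unfolding counterexample_drift_def
  by (intro conjI measurable_restrict_space1 measurable_clairvoyant_drift
      clairvoyant_drift_ode_nonuniqueness clairvoyant_drift_strong_well_posedness)

section \<open>Image spaces\<close>

text \<open>The largest \<open>\<sigma>\<close>-algebra on the image that makes \<open>\<phi>\<close> measurable. With a smaller one, completeness
  of the image and adaptedness of all transported processes could fail. The image of the
  space is used as the underlying set, since path continuity is required at every sample point.\<close>

definition final_algebra :: "'a measure \<Rightarrow> ('a \<Rightarrow> 'b) \<Rightarrow> 'b measure" where
  "final_algebra N \<phi> = sigma (\<phi> ` space N) {A. A \<subseteq> \<phi> ` space N \<and> \<phi> -` A \<inter> space N \<in> sets N}"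

definition image_measure :: "'a measure \<Rightarrow> ('a \<Rightarrow> 'b) \<Rightarrow> 'b measure" where
  "image_measure M \<phi> = distr M (final_algebra M \<phi>) \<phi>"

lemma space_final_algebra [simp]: "space (final_algebra N \<phi>) = \<phi> ` space N"
  unfolding final_algebra_def by (rule space_measure_of) auto

lemma sets_final_algebra:
  fixes \<phi> :: "'a \<Rightarrow> 'b"
  shows "sets (final_algebra N \<phi>) = {A. A \<subseteq> \<phi> ` space N \<and> \<phi> -` A \<inter> space N \<in> sets N}" (is "_ = ?S")
proof -
  have "sigma_algebra (\<phi> ` space N) ?S"
    unfolding sigma_algebra_iff2
  proof (intro conjI ballI allI impI)
    fix A assume A: "A \<in> ?S"
    have "\<phi> -` (\<phi> ` space N - A) \<inter> space N = space N - (\<phi> -` A \<inter> space N)"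
      by auto
    then show "\<phi> ` space N - A \<in> ?S"
      using A by auto
  next
    fix A :: "nat \<Rightarrow> 'b set" assume A: "range A \<subseteq> ?S"
    have "\<phi> -` (\<Union>i. A i) \<inter> space N = (\<Union>i. \<phi> -` A i \<inter> space N)"
      by auto
    moreover have "\<dots> \<in> sets N"
      using A by (intro sets.countable_UN) auto
    ultimately show "(\<Union>i. A i) \<in> ?S"
      using A by auto
  qed auto
  then show ?thesis
    unfolding final_algebra_def by (simp add: sigma_algebra.sets_measure_of_eq)
qed

lemma measurable_final_algebra: "\<phi> \<in> measurable N (final_algebra N \<phi>)"
  by (rule measurableI) (auto simp: sets_final_algebra)

lemma measurable_final_algebra_iff:
  "f \<in> measurable (final_algebra N \<phi>) L \<longleftrightarrow> (\<lambda>\<omega>. f (\<phi> \<omega>)) \<in> measurable N L"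
proof
  show "f \<in> measurable (final_algebra N \<phi>) L \<Longrightarrow> (\<lambda>\<omega>. f (\<phi> \<omega>)) \<in> measurable N L"
    by (rule measurable_compose[OF measurable_final_algebra])
next
  assume f: "(\<lambda>\<omega>. f (\<phi> \<omega>)) \<in> measurable N L"
  show "f \<in> measurable (final_algebra N \<phi>) L"
  proof (rule measurableI)
    show "f x \<in> space L" if "x \<in> space (final_algebra N \<phi>)" for x
      using that measurable_space[OF f] by auto
    fix A assume "A \<in> sets L"
    then have "(\<lambda>\<omega>. f (\<phi> \<omega>)) -` A \<inter> space N \<in> sets N"
      by (rule measurable_sets[OF f])
    moreover have "(\<lambda>\<omega>. f (\<phi> \<omega>)) -` A \<inter> space N = \<phi> -` (f -` A \<inter> \<phi> ` space N) \<inter> space N"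
      by auto
    ultimately show "f -` A \<inter> space (final_algebra N \<phi>) \<in> sets (final_algebra N \<phi>)"
      by (auto simp: sets_final_algebra)
  qed
qed

lemma space_image_measure [simp]: "space (image_measure M \<phi>) = \<phi> ` space M"
  by (simp add: image_measure_def)

lemma sets_image_measure: "sets (image_measure M \<phi>) = sets (final_algebra M \<phi>)"
  by (simp add: image_measure_def)

lemma measurable_image_measure_iff:
  "f \<in> measurable (image_measure M \<phi>) L \<longleftrightarrow> (\<lambda>\<omega>. f (\<phi> \<omega>)) \<in> measurable M L"
  unfolding measurable_final_algebra_iff[symmetric] image_measure_def by simp

lemma emeasure_image_measure:
  "A \<in> sets (image_measure M \<phi>) \<Longrightarrow> emeasure (image_measure M \<phi>) A = emeasure M (\<phi> -` A \<inter> space M)"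
  unfolding image_measure_def by (subst emeasure_distr[OF measurable_final_algebra]) auto

lemma null_sets_image_measure_iff:
  "A \<in> null_sets (image_measure M \<phi>) \<longleftrightarrow> A \<subseteq> \<phi> ` space M \<and> \<phi> -` A \<inter> space M \<in> null_sets M"
  using emeasure_image_measure[of A M \<phi>]
  by (auto simp: null_sets_def sets_image_measure sets_final_algebra)

lemma AE_image_measureD:
  "AE x in image_measure M \<phi>. P x \<Longrightarrow> AE \<omega> in M. P (\<phi> \<omega>)"
  unfolding image_measure_def by (rule AE_distrD[OF measurable_final_algebra])

text \<open>By completeness the exceptional set, which need not be given as a measurable set in the image, has
  a null preimage and thus is itself a null set of the image.\<close>

lemma AE_image_measureI:
  assumes M: "complete_measure M" and ae: "AE \<omega> in M. P (\<phi> \<omega>)"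
  shows "AE x in image_measure M \<phi>. P x"
proof (rule AE_I')
  let ?A = "{x \<in> \<phi> ` space M. \<not> P x}"
  obtain N where N: "N \<in> null_sets M" "{\<omega> \<in> space M. \<not> P (\<phi> \<omega>)} \<subseteq> N"
    using ae unfolding eventually_ae_filter by auto
  have "\<phi> -` ?A \<inter> space M = {\<omega> \<in> space M. \<not> P (\<phi> \<omega>)}"
    by auto
  moreover have "{\<omega> \<in> space M. \<not> P (\<phi> \<omega>)} \<in> null_sets M"
    using complete_measure.complete[OF M N(2,1)] N by (metis null_sets_subset)
  ultimately show "?A \<in> null_sets (image_measure M \<phi>)"
    by (auto simp: null_sets_image_measure_iff)
qed auto

lemma prob_space_image_measure: "prob_space M \<Longrightarrow> prob_space (image_measure M \<phi>)"
  unfolding image_measure_def by (rule prob_space.prob_space_distr[OF _ measurable_final_algebra])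

lemma distr_image_measure:
  assumes "(\<lambda>\<omega>. f (\<phi> \<omega>)) \<in> measurable M L"
  shows "distr (image_measure M \<phi>) L f = distr M L (\<lambda>\<omega>. f (\<phi> \<omega>))"
  unfolding image_measure_def
  using assms by (subst distr_distr) (auto simp: measurable_final_algebra measurable_final_algebra_iff comp_def)

lemma distributed_image_measure:
  assumes "distributed M L (\<lambda>\<omega>. f (\<phi> \<omega>)) p"
  shows "distributed (image_measure M \<phi>) L f p"
  using assms distr_image_measure[of f \<phi> M L]
  by (auto simp: distributed_def measurable_image_measure_iff)

text \<open>Independence is a property of the joint law, and the joint law of the variables on the image is
  that of their compositions with \<open>\<phi>\<close>.\<close>

lemma indep_vars_image_measure:
  assumes M: "prob_space M" and I: "I \<noteq> {}" and X: "prob_space.indep_vars M K (\<lambda>i \<omega>. X i (\<phi> \<omega>)) I"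
  shows "prob_space.indep_vars (image_measure M \<phi>) K X I"
proof -
  interpret M: prob_space M by fact
  interpret M': prob_space "image_measure M \<phi>" by (rule prob_space_image_measure[OF M])
  have meas: "(\<lambda>\<omega>. X i (\<phi> \<omega>)) \<in> measurable M (K i)" if "i \<in> I" for i
    using X that unfolding M.indep_vars_def by blast
  have "distr M (Pi\<^sub>M I K) (\<lambda>\<omega>. \<lambda>i\<in>I. X i (\<phi> \<omega>)) = Pi\<^sub>M I (\<lambda>i. distr M (K i) (\<lambda>\<omega>. X i (\<phi> \<omega>)))"
    using X M.indep_vars_iff_distr_eq_PiM'[OF I, of "\<lambda>i \<omega>. X i (\<phi> \<omega>)" K] meas by auto
  also have "distr M (Pi\<^sub>M I K) (\<lambda>\<omega>. \<lambda>i\<in>I. X i (\<phi> \<omega>)) =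
      distr (image_measure M \<phi>) (Pi\<^sub>M I K) (\<lambda>x. \<lambda>i\<in>I. X i x)"
    by (rule distr_image_measure[symmetric]) (intro measurable_restrict meas)
  also have "Pi\<^sub>M I (\<lambda>i. distr M (K i) (\<lambda>\<omega>. X i (\<phi> \<omega>))) = Pi\<^sub>M I (\<lambda>i. distr (image_measure M \<phi>) (K i) (X i))"
    by (rule PiM_cong) (auto simp: distr_image_measure meas)
  finally show ?thesis
    using M'.indep_vars_iff_distr_eq_PiM'[OF I, of X K] meas
    by (auto simp: measurable_image_measure_iff)
qed

lemma standard_bm_image_measure:
  assumes M: "prob_space M" and W: "standard_bm M W" and W': "\<And>t \<omega>. 0 \<le> t \<Longrightarrow> W t \<omega> = W' t (\<phi> \<omega>)"
  shows "standard_bm (image_measure M \<phi>) W'"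
  unfolding standard_bm_def
proof (intro conjI allI impI ballI)
  have eq: "W t = (\<lambda>\<omega>. W' t (\<phi> \<omega>))" if "0 \<le> t" for t
    using W'[OF that] by (rule ext)
  show meas: "W' t \<in> borel_measurable (image_measure M \<phi>)" if "0 \<le> t" for t
    using W that by (simp add: standard_bm_def measurable_image_measure_iff eq)
  have "AE \<omega> in M. W' 0 (\<phi> \<omega>) = 0"
    using W by (simp add: standard_bm_def eq)
  moreover have "{x \<in> space (final_algebra M \<phi>). W' 0 x = 0} \<in> sets (final_algebra M \<phi>)"
    using measurable_sets[OF meas[of 0], of "{0}"]
    by (auto simp: sets_image_measure vimage_def Collect_conj_eq Int_commute)
  ultimately show "AE x in image_measure M \<phi>. W' 0 x = 0"
    unfolding image_measure_def by (subst AE_distr_iff[OF measurable_final_algebra])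
  show "continuous_on {0..} (\<lambda>t. W' t x)" if x: "x \<in> space (image_measure M \<phi>)" for x
  proof -
    obtain \<omega> where \<omega>: "\<omega> \<in> space M" "x = \<phi> \<omega>" using x by auto
    then have "continuous_on {0..} (\<lambda>t. W t \<omega>)"
      using W by (simp add: standard_bm_def)
    then show ?thesis
      by (rule continuous_on_eq) (simp add: W' \<omega>)
  qed
  show "distributed (image_measure M \<phi>) lborel (\<lambda>x. W' t x - W' s x) (normal_density 0 (sqrt (t - s)))"
    if "0 \<le> s \<and> s < t" for s t
  proof (rule distributed_image_measure)
    have "(\<lambda>\<omega>. W' t (\<phi> \<omega>) - W' s (\<phi> \<omega>)) = (\<lambda>\<omega>. W t \<omega> - W s \<omega>)"
      using that by (simp add: W')
    moreover have "distributed M lborel (\<lambda>\<omega>. W t \<omega> - W s \<omega>) (normal_density 0 (sqrt (t - s)))"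
      using W that by (simp add: standard_bm_def)
    ultimately show "distributed M lborel (\<lambda>\<omega>. W' t (\<phi> \<omega>) - W' s (\<phi> \<omega>)) (normal_density 0 (sqrt (t - s)))"
      by (simp only:)
  qed
  show "prob_space.indep_vars (image_measure M \<phi>) (\<lambda>_. borel) (\<lambda>k x. W' (t (Suc k)) x - W' (t k) x) UNIV"
    if t: "0 \<le> t 0 \<and> incseq t" for t :: "nat \<Rightarrow> real"
  proof (rule indep_vars_image_measure[OF M])
    have "0 \<le> t k" for k
      using t incseqD[of t 0 k] by simp
    then have "(\<lambda>k \<omega>. W (t (Suc k)) \<omega> - W (t k) \<omega>) = (\<lambda>k \<omega>. W' (t (Suc k)) (\<phi> \<omega>) - W' (t k) (\<phi> \<omega>))"
      by (simp add: W' fun_eq_iff)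
    moreover have "prob_space.indep_vars M (\<lambda>_. borel) (\<lambda>k \<omega>. W (t (Suc k)) \<omega> - W (t k) \<omega>) UNIV"
      using W t unfolding standard_bm_def by blast
    ultimately show "prob_space.indep_vars M (\<lambda>_. borel) (\<lambda>k \<omega>. W' (t (Suc k)) (\<phi> \<omega>) - W' (t k) (\<phi> \<omega>)) UNIV"
      by (simp only:)
  qed simp
qed

lemma cylindrical_bm_image_measure:
  assumes M: "prob_space M" and B: "cylindrical_bm M B" and B': "\<And>t \<omega>. 0 \<le> t \<Longrightarrow> B t \<omega> = B' t (\<phi> \<omega>)"
  shows "cylindrical_bm (image_measure M \<phi>) B'"
  unfolding cylindrical_bm_def
proof (intro conjI allI)
  show "standard_bm (image_measure M \<phi>) (\<lambda>t x. B' t x i)" for i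
    using B B' by (intro standard_bm_image_measure[OF M, of "\<lambda>t \<omega>. B t \<omega> i"]) (simp_all add: cylindrical_bm_def)
  have "(\<lambda>i \<omega>. \<lambda>t\<in>{0..}. B t \<omega> i) = (\<lambda>i \<omega>. \<lambda>t\<in>{0..}. B' t (\<phi> \<omega>) i)"
    by (intro ext) (simp add: B' restrict_def)
  then show "prob_space.indep_vars (image_measure M \<phi>) (\<lambda>_. Pi\<^sub>M {0..} (\<lambda>_. borel)) (\<lambda>i x. \<lambda>t\<in>{0..}. B' t x i) UNIV"
    using B by (intro indep_vars_image_measure[OF M]) (auto simp: cylindrical_bm_def)
qed

lemma path_law_image_measure:
  assumes M: "prob_space M" and B: "cylindrical_bm M B" and B': "\<And>t \<omega>. 0 \<le> t \<Longrightarrow> B t \<omega> = B' t (\<phi> \<omega>)"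
  shows "path_law (image_measure M \<phi>) B' = path_law M B"
proof -
  have "(\<lambda>\<omega>. \<lambda>t\<in>{0..1}. B t \<omega>) = (\<lambda>\<omega>. \<lambda>t\<in>{0..1}. B' t (\<phi> \<omega>))"
    by (intro ext) (simp add: B' restrict_def)
  then show ?thesis
    using measurable_trajectory_path_space[OF B]
    by (simp add: path_law_def distr_image_measure)
qed

lemma brownian_basis_image_measure:
  assumes basis: "brownian_basis M F B" and B': "\<And>t \<omega>. 0 \<le> t \<Longrightarrow> B t \<omega> = B' t (\<phi> \<omega>)"
  shows "brownian_basis (image_measure M \<phi>) (\<lambda>t. final_algebra (F t) \<phi>) B'"
proof -
  let ?M = "image_measure M \<phi>" and ?F = "\<lambda>t. final_algebra (F t) \<phi>"
  have M: "prob_space M" and compl: "complete_measure M" and filt: "filtration (space M) F"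
    and sub: "\<And>t. sets (F t) \<subseteq> sets M" and null: "null_sets M \<subseteq> sets (F 0)"
    and B: "cylindrical_bm M B"
    and Bt: "\<And>t. 0 \<le> t \<Longrightarrow> B t \<in> borel_measurable (F (ennreal t))"
    and ind: "\<And>s t. 0 \<le> s \<Longrightarrow> s \<le> t \<Longrightarrow> prob_space.indep_set M (sets (F (ennreal s)))
          {(\<lambda>\<omega> i. B t \<omega> i - B s \<omega> i) -` A \<inter> space M | A. A \<in> sets borel}"
    using basis by (auto simp: brownian_basis_def)
  interpret M: prob_space M by fact
  interpret M': prob_space ?M by (rule prob_space_image_measure[OF M])
  have sp [simp]: "space (F t) = space M" for t
    using filt by (simp add: filtration_def)
  have subF: "sets (?F t) \<subseteq> sets ?M" for t
    using sub by (auto simp: sets_image_measure sets_final_algebra)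
  have "complete_measure ?M"
  proof
    fix A N assume "A \<subseteq> N" "N \<in> null_sets ?M"
    then show "A \<in> sets ?M"
      using complete_measure.complete[OF compl, of "\<phi> -` A \<inter> space M" "\<phi> -` N \<inter> space M"]
      by (auto simp: sets_image_measure sets_final_algebra null_sets_image_measure_iff)
  qed
  moreover have "filtration (space ?M) ?F"
    using filt by (auto simp: filtration_def sets_final_algebra)
  moreover have "null_sets ?M \<subseteq> sets (?F 0)"
    using null by (auto simp: null_sets_image_measure_iff sets_final_algebra)
  moreover have "B' t \<in> borel_measurable (?F (ennreal t))" if "0 \<le> t" for t
    using Bt[OF that] B'[OF that] by (simp add: measurable_final_algebra_iff fun_eq_iff[of "B t"] cong: measurable_cong)
  moreover have "M'.indep_set (sets (?F (ennreal s)))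
      {(\<lambda>x i. B' t x i - B' s x i) -` A \<inter> space ?M | A. A \<in> sets borel}" if st: "0 \<le> s" "s \<le> t" for s t
  proof (rule M'.indep_setI)
    let ?d = "\<lambda>\<omega> i. B t \<omega> i - B s \<omega> i" and ?d' = "\<lambda>x i. B' t x i - B' s x i"
    have d: "?d' (\<phi> \<omega>) = ?d \<omega>" for \<omega>
      using st by (simp add: B')
    have pre: "\<phi> -` (?d' -` A \<inter> \<phi> ` space M) \<inter> space M = ?d -` A \<inter> space M" for A
      by (auto simp: vimage_def simp flip: d)
    show "sets (?F (ennreal s)) \<subseteq> sets ?M"
      by (rule subF)
    show d': "{?d' -` A \<inter> space ?M | A. A \<in> sets borel} \<subseteq> sets ?M"
    proof safe
      fix A :: "rseq set" assume "A \<in> sets borel"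
      then have "?d -` A \<inter> space M \<in> M.events"
        using M.indep_setD_ev2[OF ind[OF st]] by blast
      then show "?d' -` A \<inter> space ?M \<in> sets ?M"
        unfolding sets_image_measure sets_final_algebra space_image_measure
        by (simp only: mem_Collect_eq pre Int_lower2 simp_thms)
    qed
    fix a b assume a: "a \<in> sets (?F (ennreal s))" and b: "b \<in> {?d' -` A \<inter> space ?M | A. A \<in> sets borel}"
    then obtain A where A: "A \<in> sets borel" "b = ?d' -` A \<inter> \<phi> ` space M" by auto
    let ?pre = "\<lambda>c. \<phi> -` c \<inter> space M"
    have prob: "M'.prob c = M.prob (?pre c)" if "c \<in> sets ?M" for c
      using emeasure_image_measure[OF that] by (simp add: measure_def)
    have ab: "a \<in> sets ?M" "b \<in> sets ?M"
      using a b subF d' by blast+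
    have "M.prob (?pre a \<inter> ?pre b) = M.prob (?pre a) * M.prob (?pre b)"
    proof (rule M.indep_setD[OF ind[OF st]])
      show "?pre a \<in> sets (F (ennreal s))"
        using a by (simp add: sets_final_algebra)
      show "?pre b \<in> {?d -` A \<inter> space M | A. A \<in> sets borel}"
        using A pre[of A] by auto
    qed
    moreover have "?pre (a \<inter> b) = ?pre a \<inter> ?pre b" by auto
    ultimately show "M'.prob (a \<inter> b) = M'.prob a * M'.prob b"
      using ab by (simp add: prob)
  qed
  ultimately show ?thesis
    unfolding brownian_basis_def
    using M'.prob_space_axioms subF cylindrical_bm_image_measure[OF M B, of B' \<phi>] B' by auto
qed

lemma stopping_time_final_algebra:
  assumes "stopping_time F (\<lambda>\<omega>. \<tau> (\<phi> \<omega>))"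
  shows "stopping_time (\<lambda>t. final_algebra (F t) \<phi>) \<tau>"
  using assms by (simp add: stopping_time_def measurable_final_algebra_iff)

lemma integral_eq_at_cong:
  assumes "\<And>s. s \<in> {0..t} \<Longrightarrow> x s = x' s" and "\<beta> t = \<beta>' t" and "0 \<le> t"
  shows "integral_eq_at b \<beta> x t \<longleftrightarrow> integral_eq_at b \<beta>' x' t"
proof -
  have "set_integrable lborel {0..t} (\<lambda>s. b (s, x s) i) \<longleftrightarrow> set_integrable lborel {0..t} (\<lambda>s. b (s, x' s) i)" for i
    by (rule set_integrable_cong) (simp_all add: assms)
  moreover have "(LINT s:{0..t}|lborel. b (s, x s) i) = (LINT s:{0..t}|lborel. b (s, x' s) i)" for i
    by (rule set_lebesgue_integral_cong) (simp_all add: assms)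
  moreover have "x t = x' t"
    using assms by simp
  ultimately show ?thesis
    by (simp add: integral_eq_at_def assms(2))
qed

lemma weak_solution_image_measure_iff:
  assumes M: "complete_measure M" and sp: "\<And>t. space (F t) = space M"
    and B': "\<And>t \<omega>. 0 \<le> t \<Longrightarrow> B t \<omega> = B' t (\<phi> \<omega>)"
    and X': "\<And>t \<omega>. t \<in> {0..1} \<Longrightarrow> X t \<omega> = X' t (\<phi> \<omega>)"
    and \<tau>': "\<And>\<omega>. \<tau> \<omega> = \<tau>' (\<phi> \<omega>)"
  shows "weak_solution_upto b (image_measure M \<phi>) (\<lambda>t. final_algebra (F t) \<phi>) B' \<tau>' X' \<longleftrightarrow>
    weak_solution_upto b M F B \<tau> X"
proof -
  have "(\<forall>t\<in>{0..1}. X' t \<in> borel_measurable (final_algebra (F (ennreal t)) \<phi>)) \<longleftrightarrow>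
      (\<forall>t\<in>{0..1}. X t \<in> borel_measurable (F (ennreal t)))"
  proof (rule ball_cong[OF refl])
    fix t :: real assume "t \<in> {0..1}"
    then have "X t = (\<lambda>\<omega>. X' t (\<phi> \<omega>))" by (intro ext X')
    then show "X' t \<in> borel_measurable (final_algebra (F (ennreal t)) \<phi>) \<longleftrightarrow> X t \<in> borel_measurable (F (ennreal t))"
      by (simp add: measurable_final_algebra_iff)
  qed
  moreover have "(\<forall>x\<in>space (image_measure M \<phi>). continuous_on {0..1} (\<lambda>t. X' t x)) \<longleftrightarrow>
      (\<forall>\<omega>\<in>space M. continuous_on {0..1} (\<lambda>t. X t \<omega>))"
  proof -
    have "continuous_on {0..1} (\<lambda>t. X' t (\<phi> \<omega>)) \<longleftrightarrow> continuous_on {0..1} (\<lambda>t. X t \<omega>)" for \<omega>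
      by (rule continuous_on_cong) (simp_all add: X')
    then show ?thesis by simp
  qed
  moreover have "(AE x in image_measure M \<phi>. X' 0 x = (\<lambda>_. 0) \<and> (\<forall>t\<in>{0..1}. ennreal t \<le> \<tau>' x \<longrightarrow>
        integral_eq_at b (\<lambda>s. B' s x) (\<lambda>s. X' s x) t)) \<longleftrightarrow>
      (AE \<omega> in M. X 0 \<omega> = (\<lambda>_. 0) \<and> (\<forall>t\<in>{0..1}. ennreal t \<le> \<tau> \<omega> \<longrightarrow>
        integral_eq_at b (\<lambda>s. B s \<omega>) (\<lambda>s. X s \<omega>) t))" (is "(AE x in _. ?P' x) \<longleftrightarrow> (AE \<omega> in _. ?P \<omega>)")
  proof -
    have "integral_eq_at b (\<lambda>s. B' s (\<phi> \<omega>)) (\<lambda>s. X' s (\<phi> \<omega>)) t \<longleftrightarrow>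
        integral_eq_at b (\<lambda>s. B s \<omega>) (\<lambda>s. X s \<omega>) t" if "t \<in> {0..1}" for t \<omega>
      by (rule integral_eq_at_cong) (use that in \<open>simp_all add: X' B'\<close>)
    moreover have "X' 0 (\<phi> \<omega>) = X 0 \<omega>" for \<omega>
      by (simp add: X')
    ultimately have "?P' (\<phi> \<omega>) \<longleftrightarrow> ?P \<omega>" for \<omega>
      by (simp only: \<tau>' cong: ball_cong)
    moreover have "(AE x in image_measure M \<phi>. ?P' x) \<longleftrightarrow> (AE \<omega> in M. ?P' (\<phi> \<omega>))"
      using AE_image_measureD[where P = ?P' and M = M and \<phi> = \<phi>]
        AE_image_measureI[OF M, where P = ?P' and \<phi> = \<phi>] by (rule iffI)
    ultimately show ?thesis
      by (simp only:)
  qed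
  ultimately show ?thesis
    unfolding weak_solution_upto_def by simp
qed

lemma coincide_upto_image_measureD:
  assumes "coincide_upto (image_measure M \<phi>) \<tau>' X' Y'"
    and "\<And>t \<omega>. t \<in> {0..1} \<Longrightarrow> X t \<omega> = X' t (\<phi> \<omega>)" "\<And>t \<omega>. t \<in> {0..1} \<Longrightarrow> Y t \<omega> = Y' t (\<phi> \<omega>)"
    and "\<And>\<omega>. \<tau> \<omega> = \<tau>' (\<phi> \<omega>)"
  shows "coincide_upto M \<tau> X Y"
  using AE_image_measureD[OF assms(1)[unfolded coincide_upto_def]]
  unfolding coincide_upto_def by (simp add: assms(2-4))

text \<open>This is what carries strong solutions back: a functional of the noise on the image, composed with \<open>\<phi>\<close>, is
  a functional of the noise on the original space.\<close>

lemma measurable_completed_filtration_image_measure: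
  assumes B': "\<And>t \<omega>. 0 \<le> t \<Longrightarrow> B t \<omega> = B' t (\<phi> \<omega>)"
  shows "\<phi> \<in> measurable (completed_filtration M B t) (completed_filtration (image_measure M \<phi>) B' t)"
proof -
  let ?G = "{B s -` A \<inter> space M | s A. s \<in> {0..t} \<and> A \<in> sets borel} \<union> null_sets M"
  let ?G' = "{B' s -` A \<inter> space (image_measure M \<phi>) | s A. s \<in> {0..t} \<and> A \<in> sets borel}
    \<union> null_sets (image_measure M \<phi>)"
  have G: "?G \<subseteq> Pow (space M)"
    using sets.sets_into_space by auto
  have sp: "space (completed_filtration M B t) = space M"
    unfolding completed_filtration_def by (rule space_measure_of[OF G])
  have sets: "?G \<subseteq> sets (completed_filtration M B t)"
    unfolding completed_filtration_def sets_measure_of[OF G] by (rule sigma_sets_superset_generator)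
  show ?thesis
    unfolding completed_filtration_def[of "image_measure M \<phi>"]
  proof (rule measurable_measure_of)
    show "?G' \<subseteq> Pow (space (image_measure M \<phi>))"
      by (auto simp: null_sets_image_measure_iff)
    show "\<phi> \<in> space (completed_filtration M B t) \<rightarrow> space (image_measure M \<phi>)"
      by (auto simp: sp)
    fix C assume "C \<in> ?G'"
    then have "\<phi> -` C \<inter> space M \<in> ?G"
    proof
      assume "C \<in> null_sets (image_measure M \<phi>)"
      then show ?thesis by (simp add: null_sets_image_measure_iff)
    next
      assume "C \<in> {B' s -` A \<inter> space (image_measure M \<phi>) | s A. s \<in> {0..t} \<and> A \<in> sets borel}"
      then obtain s A where "s \<in> {0..t}" "A \<in> sets borel" "C = B' s -` A \<inter> \<phi> ` space M" by auto
      moreover from this have "\<phi> -` C \<inter> space M = B s -` A \<inter> space M"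
        by (auto simp: B')
      ultimately show ?thesis by blast
    qed
    then show "\<phi> -` C \<inter> space (completed_filtration M B t) \<in> sets (completed_filtration M B t)"
      using sets sp by auto
  qed
qed

section \<open>One sample space suffices\<close>

text \<open>Entry 1 marks the value \<open>\<infinity>\<close>, whose real part \<open>enn2real\<close> is 0.\<close>

definition ennreal_code :: "ennreal \<Rightarrow> rseq" where
  "ennreal_code c i = (if i = 0 then enn2real c else if c = \<top> then 1 else 0)"

definition ennreal_decode :: "rseq \<Rightarrow> ennreal" where
  "ennreal_decode y = (if y 1 = 1 then \<top> else ennreal (y 0))"

lemma ennreal_decode_code [simp]: "ennreal_decode (ennreal_code c) = c"
  by (simp add: ennreal_decode_def ennreal_code_def ennreal_enn2real_if)

text \<open>The half-line \<open>u \<ge> 0\<close> carries the noise. The negative arguments leave room for two processes on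
  [0,1], run backwards on \<open>[-2,-1]\<close> and on \<open>[-4,-3]\<close>, and for the stopping time, which is read at
  \<open>-5\<close>.\<close>

definition sample_code ::
    "(real \<Rightarrow> 'a \<Rightarrow> rseq) \<Rightarrow> ('a \<Rightarrow> ennreal) \<Rightarrow> (real \<Rightarrow> 'a \<Rightarrow> rseq) \<Rightarrow> (real \<Rightarrow> 'a \<Rightarrow> rseq) \<Rightarrow> 'a \<Rightarrow> path_sample" where
  "sample_code B \<tau> X Y \<omega> u =
     (if 0 \<le> u then B u \<omega> else if u \<in> {-2..-1} then X (-1 - u) \<omega>
      else if u \<in> {-4..-3} then Y (-3 - u) \<omega> else ennreal_code (\<tau> \<omega>))"

lemma sample_code_decode:
  "0 \<le> t \<Longrightarrow> B t \<omega> = sample_code B \<tau> X Y \<omega> t"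
  "t \<in> {0..1} \<Longrightarrow> X t \<omega> = sample_code B \<tau> X Y \<omega> (-1 - t)"
  "t \<in> {0..1} \<Longrightarrow> Y t \<omega> = sample_code B \<tau> X Y \<omega> (-3 - t)"
  "\<tau> \<omega> = ennreal_decode (sample_code B \<tau> X Y \<omega> (-5))"
  by (auto simp: sample_code_def)

lemma ode_nonuniqueness_any_sample_space:
  assumes "ode_nonuniqueness TYPE(path_sample) b"
  shows "ode_nonuniqueness TYPE('a) b"
  unfolding ode_nonuniqueness_def
proof (intro allI impI)
  fix M :: "'a measure" and B
  assume "prob_space M \<and> cylindrical_bm M B"
  then have M: "prob_space M" and B: "cylindrical_bm M B" by auto
  let ?\<phi> = "\<lambda>\<omega> t. B t \<omega>" and ?B = "\<lambda>t x. x t"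
  have "prob_space (image_measure M ?\<phi>)" "cylindrical_bm (image_measure M ?\<phi>) ?B"
    using prob_space_image_measure[OF M] cylindrical_bm_image_measure[OF M B, of ?B ?\<phi>] by auto
  moreover have "path_law (image_measure M ?\<phi>) ?B = path_law M B"
    using path_law_image_measure[OF M B, of ?B ?\<phi>] by simp
  ultimately show "\<exists>\<Omega>\<in>sets path_space. measure (path_law M B) \<Omega> = 1 \<and>
           (\<forall>\<beta>\<in>\<Omega>. \<exists>x y. ode_solution b \<beta> x \<and> ode_solution b \<beta> y \<and> (\<exists>t\<in>{0..1}. x t \<noteq> y t))"
    using assms[unfolded ode_nonuniqueness_def] by metis
qed

text \<open>For uniqueness the two given solutions are part of the code, so that they become solutions on the
  image. For existence the code carries zero processes in their place, and the solution found
  on the image is composed with the coding map.\<close>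

lemma strong_well_posedness_any_sample_space:
  assumes wp: "strong_well_posedness TYPE(path_sample) b"
  shows "strong_well_posedness TYPE('a) b"
  unfolding strong_well_posedness_def
proof (intro allI impI)
  fix M :: "'a measure" and F B \<tau>
  assume "brownian_basis M F B \<and> stopping_time F \<tau>"
  then have basis: "brownian_basis M F B" and \<tau>: "stopping_time F \<tau>" by auto
  have compl: "complete_measure M" and sp: "\<And>t. space (F t) = space M"
    using basis by (auto simp: brownian_basis_def filtration_def)
  let ?B = "\<lambda>t (x :: path_sample). x t" and ?\<tau> = "\<lambda>x :: path_sample. ennreal_decode (x (-5))"
  let ?X = "\<lambda>t (x :: path_sample). x (-1 - t)" and ?Y = "\<lambda>t (x :: path_sample). x (-3 - t)"
  let ?\<phi> = "sample_code B \<tau>"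
  let ?M = "\<lambda>X Y. image_measure M (?\<phi> X Y)" and ?F = "\<lambda>X Y t. final_algebra (F t) (?\<phi> X Y)"
  note code = sample_code_decode
  have wpXY: "(\<exists>Z. weak_solution_upto b (?M X Y) (?F X Y) ?B ?\<tau> Z \<and> strong_upto (?M X Y) ?B ?\<tau> Z) \<and>
      pathwise_unique_upto b (?M X Y) (?F X Y) ?B ?\<tau>" for X Y
  proof -
    have "brownian_basis (?M X Y) (?F X Y) ?B"
      by (rule brownian_basis_image_measure[OF basis]) (erule code(1))
    moreover have "stopping_time (?F X Y) ?\<tau>"
      by (rule stopping_time_final_algebra) (use \<tau> in \<open>simp flip: code(4)\<close>)
    ultimately show ?thesis
      using wp unfolding strong_well_posedness_def by blast
  qed
  have unique: "coincide_upto M \<tau> X Y"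
    if X: "weak_solution_upto b M F B \<tau> X" and Y: "weak_solution_upto b M F B \<tau> Y" for X Y
  proof (rule coincide_upto_image_measureD)
    have "weak_solution_upto b (?M X Y) (?F X Y) ?B ?\<tau> ?X \<longleftrightarrow> weak_solution_upto b M F B \<tau> X"
      by (rule weak_solution_image_measure_iff[OF compl sp]) (erule code(1-3) | rule code(4))+
    moreover have "weak_solution_upto b (?M X Y) (?F X Y) ?B ?\<tau> ?Y \<longleftrightarrow> weak_solution_upto b M F B \<tau> Y"
      by (rule weak_solution_image_measure_iff[OF compl sp]) (erule code(1-3) | rule code(4))+
    ultimately show "coincide_upto (?M X Y) ?\<tau> ?X ?Y"
      using wpXY X Y unfolding pathwise_unique_upto_def by blast
  qed (erule code(2,3) | rule code(4))+
  let ?zero = "\<lambda>_ _. (\<lambda>_. 0) :: rseq"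
  obtain Z where Z: "weak_solution_upto b (?M ?zero ?zero) (?F ?zero ?zero) ?B ?\<tau> Z" "strong_upto (?M ?zero ?zero) ?B ?\<tau> Z"
    using wpXY by blast
  let ?Z = "\<lambda>t \<omega>. Z t (?\<phi> ?zero ?zero \<omega>)"
  have sol: "weak_solution_upto b M F B \<tau> ?Z"
  proof -
    have "weak_solution_upto b (?M ?zero ?zero) (?F ?zero ?zero) ?B ?\<tau> Z \<longleftrightarrow> weak_solution_upto b M F B \<tau> ?Z"
      by (rule weak_solution_image_measure_iff[OF compl sp]) (erule code(1) | rule refl code(4))+
    then show ?thesis using Z(1) by simp
  qed
  obtain S where S: "\<And>t. t \<in> {0..1} \<Longrightarrow> S t \<in> borel_measurable (completed_filtration (?M ?zero ?zero) ?B t)"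
      and ZS: "coincide_upto (?M ?zero ?zero) ?\<tau> Z S"
    using Z(2) unfolding strong_upto_def by blast
  have "strong_upto M B \<tau> ?Z"
    unfolding strong_upto_def
  proof (intro exI conjI ballI)
    show "(\<lambda>\<omega>. S t (?\<phi> ?zero ?zero \<omega>)) \<in> borel_measurable (completed_filtration M B t)" if "t \<in> {0..1}" for t
      by (rule measurable_compose[OF measurable_completed_filtration_image_measure S[OF that]]) (erule code(1))
    show "coincide_upto M \<tau> ?Z (\<lambda>t \<omega>. S t (?\<phi> ?zero ?zero \<omega>))"
      by (rule coincide_upto_image_measureD[OF ZS]) (rule refl code(4))+
  qed
  then show "(\<exists>X. weak_solution_upto b M F B \<tau> X \<and>
             (\<forall>Y. weak_solution_upto b M F B \<tau> Y \<longrightarrow> coincide_upto M \<tau> Y X) \<and>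
             strong_upto M B \<tau> X) \<and> pathwise_unique_upto b M F B \<tau>"
    using sol unique unfolding pathwise_unique_upto_def by blast
qed

theorem theorem5:
  shows "(\<exists>b. counterexample_drift TYPE(path_sample) b) \<and>
         (\<forall>b. counterexample_drift TYPE(path_sample) b \<longrightarrow> counterexample_drift TYPE('a) b)"
  using clairvoyant_drift_counterexample ode_nonuniqueness_any_sample_space
    strong_well_posedness_any_sample_space
  unfolding counterexample_drift_def by blast

end
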